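(* Let $L=M\left(\left.\frac{p_1}{q_1},\frac{p_2}{q_2},\cdots,\frac{p_n}{q_n}\right| e\right)$ be a Montesinos link, with $p_i,q_i$ relatively prime integers for each $i$ and $e$ an integer. Let $C$ and $C'$ be distinct (oriented) components of $L$. If there are at least three $H$-tangles among the rational tangles $T_1,\dots,T_n$ of $L$, then the linking number of $C$ and $C'$ is $$lk(C,C') = \begin{cases} \pm\, lk(R_{p_k/q_k}) & \text{if } C \text{ and } C' \text{ are linked at the } \tfrac{p_k}{q_k}\text{-tangle } T_k,\\ 0 & \text{otherwise,}\end{cases}$$ where $R_{p_k/q_k}$ is the oriented rational $\frac{p_k}{q_k}$-link, and the sign $\pm$ depends on the orientations of $C$ and $C'$.
   Context: Linking number: for an oriented link diagram, a crossing between two different components is positive if the overstrand passes the understrand from left to right (as seen when travelling along the oriented understrand), and negative otherwise. The linking number of two components is half the sum of the signs of the crossings between them. Rational tangles: a 2-tangle is a proper embedding of two disjoint arcs in a 3-ball whose four endpoints lie on the boundary sphere and are labelled NW, NE, SW, SE. Let $T_0$ be the 2-tangle made of two horizontal arcs without crossings (joining NW to NE and SW to SE); its fraction is $0/1$. A rational tangle is a 2-tangle obtained from $T_0$ by horizontal and vertical twists. Let $[+1]$ be the one-crossing tangle whose overstrand has positive slope (runs from SW to NE), and $[-1]$ the one whose overstrand has negative slope. Adding a positive (resp. negative) horizontal twist means placing $[+1]$ (resp. $[-1]$) to the right of the tangle and joining adjacent endpoints; it changes the fraction $F$ to $F+1$ (resp. $F-1$). Adding a positive (resp. negative) vertical twist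 means placing $[+1]$ (resp. $[-1]$) below the tangle and joining adjacent endpoints; it changes the fraction $F$ so that $1/F$ becomes $1/F+1$ (resp. $1/F-1$), with $1/0=\infty$ and $1/\infty=0$. By Conway's theorem two rational tangles are equivalent (isotopic fixing the endpoints) if and only if their fractions are equal. A rational $\frac pq$-tangle ($p,q$ relatively prime) is a rational tangle with fraction $\frac pq$. Types: a rational tangle is a $V$-, $D$- or $H$-tangle if the strand starting at NW ends at SW, SE or NE, respectively. A $\frac pq$-tangle is a $V$-tangle iff $p$ is odd and $q$ is even, a $D$-tangle iff $p$ and $q$ are both odd, and an $H$-tangle iff $p$ is even and $q$ is odd. Rational links: the numerator closure $N(T)$ of a rational tangle $T$ is obtained by joining NW with NE and SW with SE by arcs outside the ball, without crossings. For $p$ even and $T$ a rational $\frac pq$-tangle, $N(T)$ has two components, and $R_{p/q}$ is the oriented link $N(T)$ in which the strand with endpoints NE, NW is oriented from NE to NW and the other strand is oriented from SW to SE; $lk(R_{p/q})$ is the linking number of its two components. Montesinos links: $M\left(\left.\frac{p_1}{q_1},\dots,\frac{p_n}{q_n}\right| e\right)$ is the link formed by stacking vertically, from top to bottom, rational $\frac{p_i}{q_i}$-tangles $T_1,\dots,T_n$ and then $e$ half twists, each one's SW and SE endpoints being joined to the NW and NE endpoints, respectively, of the next one, and finally joining the SW and SE endpoints of the bottom piece to the NW and NE endpoints of $T_1$, respectively, by two arcs without crossings running parallel outside, so that the pieces are connected in cyclic order. The $e$ half twists are $|e|$ crossings stacked vertically, each being $[+1]$ if $e>0$ and $[-1]$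 if $e<0$ (two vertical parallel strands if $e=0$). Two distinct components $C,C'$ of $L$ are said to be linked at the $\frac{p_k}{q_k}$-tangle $T_k$ if $T_k$ is an $H$-tangle, one of its two strands belongs to $C$, and the other belongs to $C'$. *)

theory Defs
  imports Complex_Main
begin

text \<open>
  A diagram is glued from elementary pieces, each a disc with four corners which carries either two
  arcs or a single crossing. In \<open>Cross_Plus\<close> (the tangle \<open>[+1]\<close>) the overstrand runs along the
  SW--NE diagonal, in \<open>Cross_Minus\<close> (the tangle \<open>[-1]\<close>) along the NW--SE diagonal. The point \<open>(i, c)\<close>
  is corner \<open>c\<close> of the \<open>i\<close>-th piece, and \<open>joins\<close> lists the pairs of corners that are connected by an
  arc outside the pieces. Since crossingless arcs are pieces, a component without crossings
  is still visible as a set of points.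
\<close>

datatype corner = NW | NE | SW | SE

datatype piece = Horizontal_Arcs | Vertical_Arcs | Cross_Plus | Cross_Minus

type_synonym point = "nat \<times> corner"

record diagram =
  pieces :: "piece list"
  joins :: "(point \<times> point) set"

record tangle = diagram +
  ends :: "corner \<Rightarrow> point"

fun piece_strands :: "piece \<Rightarrow> (corner \<times> corner) set" where
  "piece_strands Horizontal_Arcs = {(NW, NE), (SW, SE)}"
| "piece_strands Vertical_Arcs = {(NW, SW), (NE, SE)}"
| "piece_strands Cross_Plus = {(SW, NE), (NW, SE)}"
| "piece_strands Cross_Minus = {(SW, NE), (NW, SE)}"

fun over_corners :: "piece \<Rightarrow> corner set" where
  "over_corners Cross_Plus = {SW, NE}"
| "over_corners Cross_Minus = {NW, SE}"
| "over_corners _ = {}"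

fun under_corners :: "piece \<Rightarrow> corner set" where
  "under_corners Cross_Plus = {NW, SE}"
| "under_corners Cross_Minus = {SW, NE}"
| "under_corners _ = {}"

definition points :: "'a diagram_scheme \<Rightarrow> point set" where
  "points D = {..<length (pieces D)} \<times> UNIV"

definition edges :: "'a diagram_scheme \<Rightarrow> (point \<times> point) set" where
  "edges D = {((i, a), (i, b)) | i a b. i < length (pieces D) \<and> (a, b) \<in> piece_strands (pieces D ! i)}
     \<union> joins D"

definition component_of :: "'a diagram_scheme \<Rightarrow> point \<Rightarrow> point set" where
  "component_of D x = {y. (x, y) \<in> (edges D \<union> (edges D)\<inverse>)\<^sup>*}"

text \<open>For a link diagram these are its components, for a tangle its strands.\<close>

definition components :: "'a diagram_scheme \<Rightarrow> point set set" where
  "components D = component_of D ` points D"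

text \<open>
  \<open>\<omega> (i, c)\<close> says that the strand through corner \<open>c\<close> of piece \<open>i\<close> is directed into that piece.
  Following a strand through a piece, or along a join from one piece to the next, one alternately
  enters and leaves pieces.
\<close>

definition orientation :: "'a diagram_scheme \<Rightarrow> (point \<Rightarrow> bool) \<Rightarrow> bool" where
  "orientation D \<omega> \<longleftrightarrow> (\<forall>(x, y) \<in> edges D. \<omega> x \<noteq> \<omega> y)"

text \<open>The corner on one's left when crossing a piece diagonally, starting from the given corner.\<close>

fun left_of :: "corner \<Rightarrow> corner" where
  "left_of NW = NE"
| "left_of SE = SW"
| "left_of SW = NW"
| "left_of NE = SE"

text \<open>
  A crossing is positive iff the overstrand enters it on the left of the understrand, as seen when
  travelling along the understrand; it then leaves on the right.
\<close>

definition crossing_sign :: "'a diagram_scheme \<Rightarrow> (point \<Rightarrow> bool) \<Rightarrow> nat \<Rightarrow> int" where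
  "crossing_sign D \<omega> i =
     (if \<exists>u \<in> under_corners (pieces D ! i). \<omega> (i, u) \<and> \<omega> (i, left_of u) then 1 else -1)"

definition crossings_between :: "'a diagram_scheme \<Rightarrow> point set \<Rightarrow> point set \<Rightarrow> nat set" where
  "crossings_between D C C' = {i. i < length (pieces D) \<and>
     (\<exists>a \<in> over_corners (pieces D ! i). \<exists>b \<in> under_corners (pieces D ! i).
        (i, a) \<in> C \<and> (i, b) \<in> C' \<or> (i, a) \<in> C' \<and> (i, b) \<in> C)}"

definition linking_number ::
  "'a diagram_scheme \<Rightarrow> (point \<Rightarrow> bool) \<Rightarrow> point set \<Rightarrow> point set \<Rightarrow> rat" where
  "linking_number D \<omega> C C' = of_int (\<Sum>i \<in> crossings_between D C C'. crossing_sign D \<omega> i) / 2"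

definition shift :: "nat \<Rightarrow> point \<Rightarrow> point" where
  "shift m = map_prod ((+) m) id"

definition elementary :: "piece \<Rightarrow> tangle" where
  "elementary P = \<lparr>pieces = [P], joins = {}, ends = (\<lambda>c. (0, c))\<rparr>"

text \<open>In both operations the pieces of the second tangle are renumbered to follow those of the first.\<close>

definition place_right :: "tangle \<Rightarrow> tangle \<Rightarrow> tangle" where
  "place_right T U = (let s = shift (length (pieces T)) in
     \<lparr>pieces = pieces T @ pieces U,
      joins = joins T \<union> map_prod s s ` joins U
        \<union> {(ends T NE, s (ends U NW)), (ends T SE, s (ends U SW))},
      ends = (\<lambda>c. if c \<in> {NW, SW} then ends T c else s (ends U c))\<rparr>)"

definition place_below :: "tangle \<Rightarrow> tangle \<Rightarrow> tangle" where
  "place_below T U = (let s = shift (length (pieces T)) in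
     \<lparr>pieces = pieces T @ pieces U,
      joins = joins T \<union> map_prod s s ` joins U
        \<union> {(ends T SW, s (ends U NW)), (ends T SE, s (ends U NE))},
      ends = (\<lambda>c. if c \<in> {NW, NE} then ends T c else s (ends U c))\<rparr>)"

definition numerator_closure :: "tangle \<Rightarrow> diagram" where
  "numerator_closure T = \<lparr>pieces = pieces T,
     joins = joins T \<union> {(ends T NW, ends T NE), (ends T SW, ends T SE)}\<rparr>"

definition vertical_closure :: "tangle \<Rightarrow> diagram" where
  "vertical_closure T = \<lparr>pieces = pieces T,
     joins = joins T \<union> {(ends T SW, ends T NW), (ends T SE, ends T NE)}\<rparr>"

text \<open>Fractions live in the rationals extended by \<open>None\<close>, which stands for \<open>1/0 = \<infinity>\<close>.\<close>

definition frac :: "int \<Rightarrow> int \<Rightarrow> rat option" where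
  "frac p q = (if q = 0 then None else Some (of_int p / of_int q))"

definition frac_add :: "rat option \<Rightarrow> rat \<Rightarrow> rat option" where
  "frac_add F r = map_option (\<lambda>x. x + r) F"

fun frac_inverse :: "rat option \<Rightarrow> rat option" where
  "frac_inverse None = Some 0"
| "frac_inverse (Some x) = (if x = 0 then None else Some (1 / x))"

inductive rational_tangle :: "tangle \<Rightarrow> rat option \<Rightarrow> bool" where
  zero: "rational_tangle (elementary Horizontal_Arcs) (Some 0)"
| right_plus: "rational_tangle T F \<Longrightarrow>
    rational_tangle (place_right T (elementary Cross_Plus)) (frac_add F 1)"
| right_minus: "rational_tangle T F \<Longrightarrow>
    rational_tangle (place_right T (elementary Cross_Minus)) (frac_add F (-1))"
| below_plus: "rational_tangle T F \<Longrightarrow>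
    rational_tangle (place_below T (elementary Cross_Plus))
      (frac_inverse (frac_add (frac_inverse F) 1))"
| below_minus: "rational_tangle T F \<Longrightarrow>
    rational_tangle (place_below T (elementary Cross_Minus))
      (frac_inverse (frac_add (frac_inverse F) (-1)))"

definition rational_pq_tangle :: "int \<Rightarrow> int \<Rightarrow> tangle \<Rightarrow> bool" where
  "rational_pq_tangle p q T \<longleftrightarrow> coprime p q \<and> rational_tangle T (frac p q)"

definition H_tangle :: "tangle \<Rightarrow> bool" where
  "H_tangle T \<longleftrightarrow> ends T NE \<in> component_of T (ends T NW)"

definition oriented_rational_link :: "int \<Rightarrow> int \<Rightarrow> diagram \<Rightarrow> (point \<Rightarrow> bool) \<Rightarrow> bool" where
  "oriented_rational_link p q L \<omega> \<longleftrightarrow> (\<exists>T. rational_pq_tangle p q T \<and> L = numerator_closure T \<and>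
     orientation L \<omega> \<and> \<omega> (ends T NE) \<and> \<not> \<omega> (ends T NW) \<and> \<omega> (ends T SW) \<and> \<not> \<omega> (ends T SE))"

text \<open>
  The linking number of \<open>R\<^bsub>p/q\<^esub>\<close>, meaningful for even \<open>p\<close>. The description ranges over all
  rational tangles with fraction \<open>p/q\<close>, so it presupposes that the linking number does not depend
  on the chosen tangle.
\<close>

definition lk_R :: "int \<Rightarrow> int \<Rightarrow> rat" where
  "lk_R p q = (THE l. \<exists>L \<omega> C C'. oriented_rational_link p q L \<omega> \<and>
     components L = {C, C'} \<and> C \<noteq> C' \<and> l = linking_number L \<omega> C C')"

text \<open>
  The final pair of vertical arcs is the case \<open>e = 0\<close>; for \<open>e \<noteq> 0\<close> it merely prolongs the two strands
  below the last crossing.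
\<close>

definition half_twists :: "int \<Rightarrow> tangle" where
  "half_twists e =
     foldr place_below
       (replicate (nat \<bar>e\<bar>) (elementary (if e > 0 then Cross_Plus else Cross_Minus)))
       (elementary Vertical_Arcs)"

definition montesinos_link :: "tangle list \<Rightarrow> int \<Rightarrow> diagram" where
  "montesinos_link Ts e = vertical_closure (foldr place_below Ts (half_twists e))"

text \<open>The inclusion of the points of the tangle \<open>Ts ! k\<close> into those of the Montesinos link.\<close>

definition embed :: "tangle list \<Rightarrow> nat \<Rightarrow> point \<Rightarrow> point" where
  "embed Ts k = shift (\<Sum>j<k. length (pieces (Ts ! j)))"

definition linked_at :: "tangle list \<Rightarrow> point set \<Rightarrow> point set \<Rightarrow> nat \<Rightarrow> bool" where
  "linked_at Ts C C' k \<longleftrightarrow> H_tangle (Ts ! k) \<and>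
     (\<exists>S S'. components (Ts ! k) = {S, S'} \<and> S \<noteq> S' \<and> embed Ts k ` S \<subseteq> C \<and> embed Ts k ` S' \<subseteq> C')"

end

theory Submission
  imports Defs
begin

text \<open>
  The idea is to cut the link at its \<open>H\<close>-tangles. Going around the cycle of tangles, a \<open>V\<close>- or
  \<open>D\<close>-tangle (a half twist is one too) lets two strands pass from top to bottom, while an
  \<open>H\<close>-tangle caps off the two strands arriving from above and the two arriving from below.
  If there are \<open>m > 0\<close> \<open>H\<close>-tangles, the pieces lying between two cyclically consecutive ones
  therefore form a single component, and these are all the components. Formally, the two bottom
  ends of an \<open>H\<close>-tangle are joined, and this property is handed on to every following tangle
  (\<open>bottom_joined_succ\<close>); conversely the number of \<open>H\<close>-tangles passed so far, modulo \<open>m\<close>, is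
  constant along strands (\<open>point_level_edge\<close>) and so keeps these components apart. Hence two
  different components cross only inside \<open>H\<close>-tangles at which they are linked
  (\<open>crossing_linked_at\<close>). Such a tangle has the levels \<open>r\<close> and \<open>r + 1\<close> modulo \<open>m\<close> above and below,
  and for \<open>m \<ge> 3\<close> this pair determines \<open>r\<close>; so there is at most one such tangle for given
  components, and the linking number is half the signed number of crossings between the two strands
  of that tangle.

  It remains to compare this number with the linking number of the closure of another
  rational tangle with the same fraction. This replaces the appeal to Conway's theorem by a direct
  argument. Reversing one strand changes the sign of all crossings between the two strands, so
  the signed count \<open>v\<close>, taken with respect to an orientation of the strands normalised at the four
  ends, together with the type of the tangle is a well-defined state. A twist acts on such states:
  a right twist by \<open>[+1]\<close> exchanges the types \<open>H\<close> and \<open>D\<close> and adds \<open>1\<close> to \<open>v\<close>, but for type \<open>V\<close>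
  it twists a strand around itself and, by the normalisation, turns \<open>v\<close> into \<open>- v\<close>; twists below
  do the same with \<open>H\<close> and \<open>V\<close> exchanged. The point is that the resulting \<open>v\<close> depends only on the
  fraction and not on the sequence of twists. This is proved by exhibiting the function: following
  the subtractive Euclidean algorithm one defines \<open>fraction_value p q\<close>, which is symmetric in \<open>p\<close>
  and \<open>q\<close> and odd in each of them, and verifies that it obeys all the twist laws
  (\<open>fraction_value_add\<close>). So every rational \<open>p/q\<close>-tangle carries the count \<open>fraction_value p q\<close>
  (\<open>rational_tangle_invariant\<close>), and \<open>lk_R p q\<close> is half of it (\<open>lk_R_eq\<close>).
\<close>

section \<open>A function of fractions that obeys the twist laws\<close>

text \<open>
  On positive fractions every value is forced: a fraction above \<open>1\<close> arises by a right twist, one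
  below \<open>1\<close> by a twist below. The parity tests distinguish a twist that adds a
  crossing between the strands from one that adds a self-crossing.
\<close>

fun euclid_value :: "nat \<Rightarrow> nat \<Rightarrow> int" where
  "euclid_value p q =
     (if p = 0 \<or> q = 0 then 0
      else if q \<le> p then if even q then - euclid_value (p - q) q else euclid_value (p - q) q + 1
      else if even p then - euclid_value p (q - p) else euclid_value p (q - p) + 1)"

declare euclid_value.simps [simp del]

lemma euclid_value_0 [simp]: "euclid_value 0 q = 0" "euclid_value p 0 = 0"
  by (simp_all add: euclid_value.simps)

lemma euclid_value_add:
  "euclid_value (p + q) q = (if even q then - euclid_value p q else euclid_value p q + 1)"
proof (cases "q = 0")
  case False
  then show ?thesis by (subst euclid_value.simps) simp
qed simp

lemma euclid_value_commute: "euclid_value p q = euclid_value q p"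
proof (induction p q rule: euclid_value.induct)
  case (1 p q)
  then show ?case
    using euclid_value.simps[of p q] euclid_value.simps[of q p]
    by (cases p q rule: linorder_cases) auto
qed

text \<open>
  The law for a right twist at the negative fraction \<open>- p / q\<close>. With \<open>r = q - p\<close>, one Euclidean step
  leads from \<open>(p, q)\<close> to \<open>(p, r)\<close> and from \<open>(r, q)\<close> to \<open>(r, p)\<close>, which are the same pair up to
  order; no induction is necessary.
\<close>

lemma euclid_value_diff:
  assumes "p \<le> q"
  shows "euclid_value (q - p) q = (if even q then euclid_value p q else 1 - euclid_value p q)"
proof (cases "p = 0")
  case True
  then show ?thesis using euclid_value_add[of 0 q] by simp
next
  case False
  define r where "r = q - p"
  then have q: "q = r + p" using assms by simp
  have "euclid_value p q = (if even p then - euclid_value r p else euclid_value r p + 1)"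
    using euclid_value_add[of r p] q by (simp add: euclid_value_commute)
  moreover have "euclid_value r q = (if even r then - euclid_value p r else euclid_value p r + 1)"
    using euclid_value_add[of p r] q by (metis add.commute euclid_value_commute)
  moreover have "euclid_value p r = euclid_value r p" by (rule euclid_value_commute)
  ultimately show ?thesis using q by auto
qed

text \<open>Passing to the mirror image changes the sign of the fraction and of all crossings.\<close>

definition fraction_value :: "int \<Rightarrow> int \<Rightarrow> int" where
  "fraction_value p q = sgn p * sgn q * euclid_value (nat \<bar>p\<bar>) (nat \<bar>q\<bar>)"

lemma fraction_value_commute: "fraction_value p q = fraction_value q p"
  by (simp add: fraction_value_def euclid_value_commute mult.commute)

lemma fraction_value_minus: "fraction_value (- p) q = - fraction_value p q"
  by (simp add: fraction_value_def sgn_minus)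

lemma fraction_value_minus_right: "fraction_value p (- q) = - fraction_value p q"
  by (simp add: fraction_value_def sgn_minus)

lemma fraction_value_add_pos:
  assumes "q > 0"
  shows "fraction_value (p + q) q = (if even q then - fraction_value p q else fraction_value p q + 1)"
proof -
  define b where "b = nat q"
  have b: "q = int b" "b > 0" using assms by (auto simp: b_def)
  \<comment> \<open>the fractions \<open>p / q\<close> and \<open>p / q + 1\<close> lie on different sides of \<open>0\<close> only in the middle case\<close>
  consider (pos) "p \<ge> 0" | (mid) "- q \<le> p" "p < 0" | (neg) "p < - q" by linarith
  then show ?thesis
  proof cases
    case pos
    then obtain a where a: "p = int a" using zero_le_imp_eq_int by blast
    have "nat \<bar>p + q\<bar> = a + b" "nat \<bar>p\<bar> = a" "nat \<bar>q\<bar> = b" "sgn (p + q) = 1" using a b by auto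
    then show ?thesis using euclid_value_add[of a b] a b by (cases "a = 0") (simp_all add: fraction_value_def)
  next
    case mid
    define a where "a = nat (- p)"
    have a: "p = - int a" "a \<le> b" "a > 0" using mid b by (auto simp: a_def)
    have "nat \<bar>p + q\<bar> = b - a" "nat \<bar>p\<bar> = a" "nat \<bar>q\<bar> = b" using a b by auto
    then show ?thesis using euclid_value_diff[of a b] a b by (cases "a = b") (auto simp add: fraction_value_def)
  next
    case neg
    define a where "a = nat (- p - q)"
    have a: "p = - int (a + b)" "a > 0" using neg b by (auto simp: a_def)
    have "nat \<bar>p + q\<bar> = a" "nat \<bar>p\<bar> = a + b" "nat \<bar>q\<bar> = b" "sgn (p + q) = -1" "sgn p = -1" using a b by auto
    then show ?thesis using euclid_value_add[of a b] a b by (simp add: fraction_value_def)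
  qed
qed

lemma fraction_value_add:
  "fraction_value (p + q) q = (if even q then - fraction_value p q else fraction_value p q + 1)"
proof -
  consider "q > 0" | "q = 0" | "- q > 0" by linarith
  then show ?thesis
  proof cases
    case 3
    have "fraction_value (p + q) q = fraction_value (- p + - q) (- q)"
      by (metis fraction_value_minus fraction_value_minus_right minus_add_distrib minus_minus)
    also have "\<dots> = (if even q then - fraction_value (- p) (- q) else fraction_value (- p) (- q) + 1)"
      using fraction_value_add_pos[OF 3, of "- p"] by simp
    finally show ?thesis by (simp add: fraction_value_minus fraction_value_minus_right)
  qed (simp_all add: fraction_value_add_pos, simp add: fraction_value_def)
qed

lemma fraction_value_diff:
  "fraction_value (p - q) q = (if even q then - fraction_value p q else fraction_value p q - 1)"
  using fraction_value_add[of "p - q" q] by auto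

lemma coprime_frac_eq:
  assumes "coprime p q" "coprime p' q'" "frac p q = frac p' q'"
  shows "p' = p \<and> q' = q \<or> p' = - p \<and> q' = - q"
proof (cases "q = 0")
  case True
  then have "q' = 0" using assms(3) by (simp add: frac_def split: if_splits)
  then have "\<bar>p\<bar> = 1" "\<bar>p'\<bar> = 1" using assms True by auto
  then show ?thesis using True \<open>q' = 0\<close> by linarith
next
  case False
  then have q': "q' \<noteq> 0" using assms(3) by (simp add: frac_def split: if_splits)
  then have "(of_int p / of_int q :: rat) = of_int p' / of_int q'"
    using False assms(3) by (simp add: frac_def)
  then have "(of_int (p * q') :: rat) = of_int (p' * q)"
    using False q' by (simp add: field_simps)
  then have eq: "p * q' = p' * q" by (simp only: of_int_eq_iff)
  have "q dvd q'" "q' dvd q"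
    using eq assms by (metis coprime_commute coprime_dvd_mult_right_iff dvd_triv_right,
      metis coprime_commute coprime_dvd_mult_right_iff dvd_triv_right)
  then have "\<bar>q\<bar> = \<bar>q'\<bar>" by (rule zdvd_antisym_abs)
  then consider "q' = q" | "q' = - q" by linarith
  then show ?thesis
  proof cases
    case 2
    then have "(- p) * q = p' * q" using eq by simp
    then have "p' = - p" using False by (simp only: mult_cancel_right) simp
    then show ?thesis using 2 by simp
  qed (use eq False in simp)
qed

section \<open>Connected points of a diagram\<close>

abbreviation connection :: "'a diagram_scheme \<Rightarrow> (point \<times> point) set" where
  "connection D \<equiv> (edges D \<union> (edges D)\<inverse>)\<^sup>*"

lemma connection_sym: "(x, y) \<in> connection D \<Longrightarrow> (y, x) \<in> connection D"
  by (metis converse_Un converse_converse rtrancl_converseI sup_commute)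

lemma component_of_eq_iff: "component_of D x = component_of D y \<longleftrightarrow> (x, y) \<in> connection D"
proof
  assume "component_of D x = component_of D y"
  then show "(x, y) \<in> connection D" unfolding component_of_def by blast
next
  assume "(x, y) \<in> connection D"
  then show "component_of D x = component_of D y"
    unfolding component_of_def by (blast intro: rtrancl_trans connection_sym)
qed

lemma connection_image:
  assumes "\<And>x y. (x, y) \<in> edges D \<Longrightarrow> (f x, f y) \<in> edges E" and "(x, y) \<in> connection D"
  shows "(f x, f y) \<in> connection E"
  using assms(2) by induction (auto intro: assms(1) rtrancl_into_rtrancl)

lemma connection_invariant:
  assumes "\<And>x y. (x, y) \<in> edges D \<Longrightarrow> g x = g y" and "(x, y) \<in> connection D"
  shows "g x = g y"
  using assms(2) by induction (auto dest: assms(1))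

lemma edge_connection: "(x, y) \<in> edges D \<Longrightarrow> (x, y) \<in> connection D"
  by blast

lemma connection_eqI:
  assumes "edges D \<subseteq> edges E" and "edges E \<subseteq> connection D"
  shows "connection E = connection D"
proof
  have "edges E \<union> (edges E)\<inverse> \<subseteq> connection D"
    using assms(2) connection_sym by blast
  then show "connection E \<subseteq> connection D" by (rule rtrancl_subset_rtrancl)
next
  show "connection D \<subseteq> connection E" using assms(1) by (intro rtrancl_mono) blast
qed

lemma edges_in_points:
  assumes "joins D \<subseteq> points D \<times> points D" and "(x, y) \<in> edges D"
  shows "x \<in> points D \<and> y \<in> points D"
  using assms by (auto simp: edges_def points_def)

lemma connection_in_points:
  assumes "joins D \<subseteq> points D \<times> points D" and "(x, y) \<in> connection D" and "x \<in> points D"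
  shows "y \<in> points D"
  using assms(2,3) by induction (auto dest: edges_in_points[OF assms(1)])

section \<open>Tangles with two strands\<close>

datatype tangle_type = V_type | D_type | H_type

fun fraction_type :: "int \<Rightarrow> int \<Rightarrow> tangle_type" where
  "fraction_type p q = (if even q then V_type else if even p then H_type else D_type)"

fun joined_to_NW :: "tangle_type \<Rightarrow> corner \<Rightarrow> bool" where
  "joined_to_NW V_type c = (c \<in> {NW, SW})"
| "joined_to_NW D_type c = (c \<in> {NW, SE})"
| "joined_to_NW H_type c = (c \<in> {NW, NE})"

text \<open>
  \<open>lab\<close> marks the points of the strand that starts at NW. That each marking class is connected
  excludes closed components inside the tangle. Asking for \<open>lab\<close> to be constant along edges rather than
  describing the strands as paths makes both halves of the condition easy to extend to a
  further crossing.
\<close>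

definition two_stranded :: "tangle \<Rightarrow> tangle_type \<Rightarrow> (point \<Rightarrow> bool) \<Rightarrow> bool" where
  "two_stranded T t lab \<longleftrightarrow>
     joins T \<subseteq> points T \<times> points T \<and> range (ends T) \<subseteq> points T \<and>
     (\<forall>(x, y) \<in> edges T. lab x = lab y) \<and>
     (\<forall>x \<in> points T. \<forall>y \<in> points T. lab x = lab y \<longrightarrow> (x, y) \<in> connection T) \<and>
     (\<forall>c. lab (ends T c) = joined_to_NW t c)"

lemma two_strandedD:
  assumes "two_stranded T t lab"
  shows "ends T c \<in> points T" "lab (ends T c) = joined_to_NW t c"
    "(x, y) \<in> edges T \<Longrightarrow> lab x = lab y"
    "(x, y) \<in> connection T \<Longrightarrow> lab x = lab y"
    "x \<in> points T \<Longrightarrow> y \<in> points T \<Longrightarrow> lab x = lab y \<Longrightarrow> (x, y) \<in> connection T"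
  using assms connection_invariant[of T lab x y] unfolding two_stranded_def by blast+

lemma component_of_two_stranded:
  assumes "two_stranded T t lab" and "x \<in> points T"
  shows "component_of T x = {y \<in> points T. lab y = lab x}"
proof -
  have "joins T \<subseteq> points T \<times> points T" using assms(1) by (simp add: two_stranded_def)
  then have "(x, y) \<in> connection T \<longleftrightarrow> y \<in> points T \<and> lab y = lab x" for y
    using assms connection_in_points two_strandedD(4,5) by metis
  then show ?thesis unfolding component_of_def by simp
qed

lemma components_two_stranded:
  assumes "two_stranded T t lab"
  shows "components T = {{x \<in> points T. lab x}, {x \<in> points T. \<not> lab x}}"
proof -
  obtain c d where c: "ends T c \<in> points T" "lab (ends T c)"
    and d: "ends T d \<in> points T" "\<not> lab (ends T d)"
    using two_strandedD(1,2)[OF assms] that[of NW NE] that[of NW SE] by (cases t) simp_all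
  have "components T = (\<lambda>x. {y \<in> points T. lab y = lab x}) ` points T"
    unfolding components_def by (rule image_cong) (simp_all add: component_of_two_stranded[OF assms])
  also have "\<dots> = (\<lambda>l. {y \<in> points T. lab y = l}) ` (lab ` points T)"
    by (simp add: image_image)
  also have "lab ` points T = {True, False}"
    using c d by (auto simp: image_iff)
  finally show ?thesis by simp
qed

lemma H_tangle_iff:
  assumes "two_stranded T t lab"
  shows "H_tangle T \<longleftrightarrow> t = H_type"
  using two_strandedD(1,2)[OF assms]
  by (cases t) (simp_all add: H_tangle_def component_of_two_stranded[OF assms])

section \<open>The effect of a twist on crossings and orientations\<close>

definition interstrand_sum :: "tangle \<Rightarrow> (point \<Rightarrow> bool) \<Rightarrow> (point \<Rightarrow> bool) \<Rightarrow> int" where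
  "interstrand_sum T lab \<omega> =
     (\<Sum>i \<in> crossings_between T {x. lab x} {x. \<not> lab x}. crossing_sign T \<omega> i)"

lemma crossings_between_lab:
  "crossings_between D {x. lab x} {x. \<not> lab x} = {i. i < length (pieces D) \<and>
     (\<exists>a \<in> over_corners (pieces D ! i). \<exists>b \<in> under_corners (pieces D ! i). lab (i, a) \<noteq> lab (i, b))}"
  unfolding crossings_between_def by auto

definition crossing_value :: "piece \<Rightarrow> int" where
  "crossing_value P = (if P = Cross_Plus then 1 else - 1)"

text \<open>
  A horizontal and a vertical twist both attach a crossing to two adjacent ends \<open>a\<close>, \<open>b\<close> of the
  tangle; the end \<open>a\<close> meets the NW corner of the crossing, and \<open>b\<close> meets its corner \<open>b'\<close>.
\<close>

locale added_crossing =
  fixes T T' :: tangle and P :: piece and a b b' :: corner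
  assumes P: "P \<in> {Cross_Plus, Cross_Minus}"
    and pieces: "pieces T' = pieces T @ [P]"
    and joins: "joins T' = joins T \<union>
      {(ends T a, (length (pieces T), NW)), (ends T b, (length (pieces T), b'))}"
    and b': "b' \<in> {SW, NE}"
begin

abbreviation m :: nat where "m \<equiv> length (pieces T)"

lemma points': "points T' = points T \<union> {m} \<times> UNIV"
  by (auto simp: points_def pieces)

lemma edges': "edges T' = edges T \<union> {((m, SW), (m, NE)), ((m, NW), (m, SE))}
    \<union> {(ends T a, (m, NW)), (ends T b, (m, b'))}"
  using P by (auto simp: edges_def pieces joins nth_append less_Suc_eq)

text \<open>Through the new crossing, each strand continues along the diagonal it has entered.\<close>

definition extend :: "(point \<Rightarrow> bool) \<Rightarrow> point \<Rightarrow> bool" where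
  "extend lab x = (if x \<in> points T then lab x
     else lab (ends T (if snd x \<in> {NW, SE} then a else b)))"

lemma new_notin: "(m, c) \<notin> points T"
  by (simp add: points_def)

lemma extend_old: "x \<in> points T \<Longrightarrow> extend lab x = lab x"
  by (simp add: extend_def)

lemma extend_new: "extend lab (m, c) = lab (ends T (if c \<in> {NW, SE} then a else b))"
  by (simp add: extend_def new_notin)

lemma two_stranded_extend:
  assumes "two_stranded T t lab" and "range (ends T') \<subseteq> points T'"
    and "\<And>c. extend lab (ends T' c) = joined_to_NW t' c"
  shows "two_stranded T' t' (extend lab)"
proof -
  note ends_in = two_strandedD(1)[OF assms(1)]
  have j: "joins T \<subseteq> points T \<times> points T" using assms(1) by (simp add: two_stranded_def)
  have "joins T' \<subseteq> points T' \<times> points T'"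
    using j ends_in by (auto simp: joins points')
  moreover have "extend lab x = extend lab y" if "(x, y) \<in> edges T'" for x y
  proof (cases "(x, y) \<in> edges T")
    case True
    then show ?thesis
      using two_strandedD(3)[OF assms(1) True] edges_in_points[OF j True] by (simp add: extend_old)
  next
    case False
    then show ?thesis
      using that ends_in b' unfolding edges' by (auto simp: extend_old extend_new)
  qed
  moreover have "(x, y) \<in> connection T'"
    if xy: "x \<in> points T'" "y \<in> points T'" "extend lab x = extend lab y" for x y
  proof -
    \<comment> \<open>move both points along their strands into the old tangle\<close>
    have "\<exists>x0 \<in> points T. (x, x0) \<in> connection T' \<and> lab x0 = extend lab x" if "x \<in> points T'" for x
    proof (cases "x \<in> points T")
      case True
      then show ?thesis by (auto simp: extend_old)
    next
      case False
      then obtain c where x: "x = (m, c)" using \<open>x \<in> points T'\<close> unfolding points' by blast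
      have e: "((m, SW), (m, NE)) \<in> edges T'" "((m, NW), (m, SE)) \<in> edges T'"
        "(ends T a, (m, NW)) \<in> edges T'" "(ends T b, (m, b')) \<in> edges T'"
        by (auto simp: edges')
      have "(x, ends T (if c \<in> {NW, SE} then a else b)) \<in> connection T'"
        using e[THEN edge_connection] e[THEN edge_connection, THEN connection_sym] b'
        by (cases c) (auto simp: x intro: rtrancl_trans)
      then show ?thesis using ends_in by (auto simp: x extend_new)
    qed
    then obtain x0 y0 where x0: "x0 \<in> points T" "(x, x0) \<in> connection T'" "lab x0 = extend lab x"
      and y0: "y0 \<in> points T" "(y, y0) \<in> connection T'" "lab y0 = extend lab y"
      using xy by metis
    have "(x0, y0) \<in> connection T"
      using two_strandedD(5)[OF assms(1)] x0 y0 xy by simp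
    then have "(x0, y0) \<in> connection T'"
      by (rule connection_image[where f = id, simplified, rotated]) (simp add: edges')
    then show ?thesis using x0 y0 by (meson connection_sym rtrancl_trans)
  qed
  ultimately show ?thesis using assms(2,3) unfolding two_stranded_def by blast
qed

lemma interstrand_sum_extend:
  "interstrand_sum T' (extend lab) \<omega> = interstrand_sum T lab \<omega> +
     (if lab (ends T a) \<noteq> lab (ends T b) then crossing_sign T' \<omega> m else 0)"
proof -
  let ?S = "crossings_between T {x. lab x} {x. \<not> lab x}"
  let ?S' = "crossings_between T' {x. extend lab x} {x. \<not> extend lab x}"
  have S': "?S' = ?S \<union> (if lab (ends T a) \<noteq> lab (ends T b) then {m} else {})"
    using P by (auto simp: crossings_between_lab pieces nth_append less_Suc_eq extend_new
        extend_old points_def)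
  have fin: "finite ?S" and new: "m \<notin> ?S" unfolding crossings_between_lab by auto
  have old: "(\<Sum>i \<in> ?S. crossing_sign T' \<omega> i) = (\<Sum>i \<in> ?S. crossing_sign T \<omega> i)"
    by (rule sum.cong) (auto simp: crossing_sign_def crossings_between_lab pieces nth_append)
  show ?thesis
    using fin new old unfolding interstrand_sum_def S' by simp
qed

lemma orientation_old: "orientation T' \<omega> \<Longrightarrow> orientation T \<omega>"
  by (auto simp: orientation_def edges')

lemma orientation_new:
  assumes "orientation T' \<omega>"
  shows "\<omega> (m, NW) \<longleftrightarrow> \<not> \<omega> (ends T a)" "\<omega> (m, SE) \<longleftrightarrow> \<omega> (ends T a)"
    "\<omega> (m, b') \<longleftrightarrow> \<not> \<omega> (ends T b)" "\<omega> (m, SW) \<longleftrightarrow> \<not> \<omega> (m, NE)"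
  using assms by (auto simp: orientation_def edges')

lemma crossing_sign_new:
  assumes "orientation T' \<omega>"
  shows "crossing_sign T' \<omega> m = crossing_value P *
     (if \<omega> (m, NW) = \<omega> (m, SW) then -1 else 1)"
  using P orientation_new[OF assms] by (auto simp: crossing_sign_def crossing_value_def pieces)

end

section \<open>Twists act on normalised crossing counts\<close>

text \<open>
  Which of the two relative orientations of the strands counts as positive. In type \<open>H\<close> it is the one of
  \<open>oriented_rational_link\<close>. In type \<open>D\<close> the conditions of the types \<open>V\<close> and
  \<open>H\<close> agree, because NE and SW are ends of one strand and so directed oppositely; this agreement
  makes a twist between different strands preserve the sign.
\<close>

fun relative_sign :: "tangle_type \<Rightarrow> (corner \<Rightarrow> bool) \<Rightarrow> int" where
  "relative_sign V_type d = (if d NW = d NE then 1 else -1)"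
| "relative_sign D_type d = (if d NW = d SW then -1 else 1)"
| "relative_sign H_type d = (if d NW = d SW then -1 else 1)"

text \<open>A strand that enters the tangle at one end leaves it at the other.\<close>

fun ends_alternate :: "tangle_type \<Rightarrow> (corner \<Rightarrow> bool) \<Rightarrow> bool" where
  "ends_alternate V_type d \<longleftrightarrow> d NW \<noteq> d SW \<and> d NE \<noteq> d SE"
| "ends_alternate D_type d \<longleftrightarrow> d NW \<noteq> d SE \<and> d NE \<noteq> d SW"
| "ends_alternate H_type d \<longleftrightarrow> d NW \<noteq> d NE \<and> d SW \<noteq> d SE"

text \<open>
  The factor \<open>relative_sign\<close> absorbs the choice of the orientation, so \<open>v\<close> belongs to the
  unoriented tangle. The condition on the ends is what allows the induction over twists to
  compute the sign of the next crossing.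
\<close>

definition rational_invariant :: "tangle \<Rightarrow> tangle_type \<Rightarrow> int \<Rightarrow> (point \<Rightarrow> bool) \<Rightarrow> bool" where
  "rational_invariant T t v lab \<longleftrightarrow> two_stranded T t lab \<and>
     (\<forall>\<omega>. orientation T \<omega> \<longrightarrow> ends_alternate t (\<omega> \<circ> ends T) \<and>
        interstrand_sum T lab \<omega> = relative_sign t (\<omega> \<circ> ends T) * v)"

text \<open>
  The action of the twists on pairs of a type and a normalised count. The sign change in the first,
  respectively last, case comes from exchanging two ends of one strand, which reverses the
  normalised orientation of that strand.
\<close>

fun twist_right :: "int \<Rightarrow> tangle_type \<times> int \<Rightarrow> tangle_type \<times> int" where
  "twist_right s (V_type, v) = (V_type, - v)"
| "twist_right s (D_type, v) = (H_type, v + s)"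
| "twist_right s (H_type, v) = (D_type, v + s)"

fun twist_below :: "int \<Rightarrow> tangle_type \<times> int \<Rightarrow> tangle_type \<times> int" where
  "twist_below s (V_type, v) = (D_type, v + s)"
| "twist_below s (D_type, v) = (V_type, v + s)"
| "twist_below s (H_type, v) = (H_type, - v)"

lemma (in added_crossing) rational_invariant_extend:
  assumes inv: "rational_invariant T t v lab"
    and ends: "\<And>c. ends T' c \<in> points T' \<and> extend lab (ends T' c) = joined_to_NW t' c"
    and step: "\<And>\<omega>. orientation T' \<omega> \<Longrightarrow> ends_alternate t (\<omega> \<circ> ends T) \<Longrightarrow>
      ends_alternate t' (\<omega> \<circ> ends T') \<and>
      relative_sign t (\<omega> \<circ> ends T) * v +
        (if joined_to_NW t a \<noteq> joined_to_NW t b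
         then crossing_value P * (if \<omega> (m, NW) = \<omega> (m, SW) then -1 else 1) else 0) =
      relative_sign t' (\<omega> \<circ> ends T') * v'"
  shows "rational_invariant T' t' v' (extend lab)"
proof -
  have two: "two_stranded T t lab" using inv by (simp add: rational_invariant_def)
  then have "two_stranded T' t' (extend lab)"
    using ends by (intro two_stranded_extend) auto
  moreover have "ends_alternate t' (\<omega> \<circ> ends T') \<and>
      interstrand_sum T' (extend lab) \<omega> = relative_sign t' (\<omega> \<circ> ends T') * v'"
    if \<omega>: "orientation T' \<omega>" for \<omega>
  proof -
    have old: "ends_alternate t (\<omega> \<circ> ends T)"
      "interstrand_sum T lab \<omega> = relative_sign t (\<omega> \<circ> ends T) * v"
      using inv orientation_old[OF \<omega>] unfolding rational_invariant_def by blast+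
    show ?thesis
      using step[OF \<omega> old(1)]
      unfolding interstrand_sum_extend crossing_sign_new[OF \<omega>] two_strandedD(2)[OF two] old(2) .
  qed
  ultimately show ?thesis unfolding rational_invariant_def by blast
qed

lemma rational_invariant_place_right:
  assumes inv: "rational_invariant T t v lab" and P: "P \<in> {Cross_Plus, Cross_Minus}"
    and t': "twist_right (crossing_value P) (t, v) = (t', v')"
  shows "\<exists>lab'. rational_invariant (place_right T (elementary P)) t' v' lab'"
proof -
  let ?T' = "place_right T (elementary P)"
  interpret added_crossing T ?T' P NE SE SW
    using P by unfold_locales (auto simp: place_right_def elementary_def shift_def Let_def)
  have ends': "ends ?T' NW = ends T NW" "ends ?T' SW = ends T SW"
    "ends ?T' NE = (m, NE)" "ends ?T' SE = (m, SE)"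
    by (simp_all add: place_right_def elementary_def shift_def Let_def)
  have two: "two_stranded T t lab" using inv by (simp add: rational_invariant_def)
  have "rational_invariant ?T' t' v' (extend lab)"
  proof (rule rational_invariant_extend[OF inv])
    show "ends ?T' c \<in> points ?T' \<and> extend lab (ends ?T' c) = joined_to_NW t' c" for c
      using t' two_strandedD(1,2)[OF two]
      by (cases c; cases t) (auto simp: ends' points' extend_old extend_new)
  qed (use t' in \<open>cases t; auto simp: ends' dest: orientation_new\<close>)
  then show ?thesis by blast
qed

lemma rational_invariant_place_below:
  assumes inv: "rational_invariant T t v lab" and P: "P \<in> {Cross_Plus, Cross_Minus}"
    and t': "twist_below (crossing_value P) (t, v) = (t', v')"
  shows "\<exists>lab'. rational_invariant (place_below T (elementary P)) t' v' lab'"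
proof -
  let ?T' = "place_below T (elementary P)"
  interpret added_crossing T ?T' P SW SE NE
    using P by unfold_locales (auto simp: place_below_def elementary_def shift_def Let_def)
  have ends': "ends ?T' NW = ends T NW" "ends ?T' NE = ends T NE"
    "ends ?T' SW = (m, SW)" "ends ?T' SE = (m, SE)"
    by (simp_all add: place_below_def elementary_def shift_def Let_def)
  have two: "two_stranded T t lab" using inv by (simp add: rational_invariant_def)
  have "rational_invariant ?T' t' v' (extend lab)"
  proof (rule rational_invariant_extend[OF inv])
    show "ends ?T' c \<in> points ?T' \<and> extend lab (ends ?T' c) = joined_to_NW t' c" for c
      using t' two_strandedD(1,2)[OF two]
      by (cases c; cases t) (auto simp: ends' points' extend_old extend_new)
  qed (use t' in \<open>cases t; auto simp: ends' dest: orientation_new\<close>)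
  then show ?thesis by blast
qed

section \<open>The crossing count of a rational tangle is determined by its fraction\<close>

fun piece_type :: "piece \<Rightarrow> tangle_type" where
  "piece_type Horizontal_Arcs = H_type"
| "piece_type Vertical_Arcs = V_type"
| "piece_type _ = D_type"

lemma edges_elementary:
  "edges (elementary P) = (\<lambda>(a, b). ((0, a), (0, b))) ` piece_strands P"
  by (auto simp: edges_def elementary_def)

lemma two_stranded_elementary:
  "two_stranded (elementary P) (piece_type P) (joined_to_NW (piece_type P) \<circ> snd)"
proof -
  have strands: "((0, a), (0, b)) \<in> connection (elementary P)" if "(a, b) \<in> piece_strands P" for a b
    using that by (intro edge_connection) (auto simp: edges_elementary)
  have "((0, a), (0, b)) \<in> connection (elementary P)"
    if "joined_to_NW (piece_type P) a = joined_to_NW (piece_type P) b" for a b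
    using that strands strands[THEN connection_sym]
    by (cases P; cases a; cases b) simp_all
  moreover have "joined_to_NW (piece_type P) a = joined_to_NW (piece_type P) b"
    if "(a, b) \<in> piece_strands P" for a b
    using that by (cases P) auto
  ultimately show ?thesis
    unfolding two_stranded_def edges_elementary
    by (simp add: points_def elementary_def) auto
qed

lemma rational_invariant_horizontal:
  "rational_invariant (elementary Horizontal_Arcs) H_type 0 (joined_to_NW H_type \<circ> snd)"
proof -
  have "crossings_between (elementary Horizontal_Arcs) A B = {}" for A B
    by (auto simp: crossings_between_def elementary_def)
  then show ?thesis
    unfolding rational_invariant_def interstrand_sum_def
    using two_stranded_elementary[of Horizontal_Arcs]
    by (simp add: orientation_def edges_elementary) (simp add: elementary_def)
qed

lemma frac_add_frac: "frac_add (frac p q) (of_int r) = frac (p + r * q) q"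
  by (auto simp: frac_add_def frac_def field_simps)

lemma frac_inverse_frac: "coprime p q \<Longrightarrow> frac_inverse (frac p q) = frac q p"
  by (auto simp: frac_def)

text \<open>
  The recursion for \<open>fraction_value\<close> and the twist laws say the same: in \<open>p / q\<close>, the parity
  of \<open>q\<close> tells whether NE and SE are ends of one strand, that of \<open>p\<close> whether SW and SE are.
\<close>

lemma twist_right_fraction:
  assumes "s \<in> {1, -1}"
  shows "twist_right s (fraction_type p q, fraction_value p q) =
    (fraction_type (p + s * q) q, fraction_value (p + s * q) q)"
  using assms fraction_value_add[of p q] fraction_value_diff[of p q] by auto

lemma twist_below_fraction:
  assumes "coprime p q" and "s \<in> {1, -1}"
  shows "twist_below s (fraction_type p q, fraction_value p q) =
    (fraction_type p (q + s * p), fraction_value p (q + s * p))"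
proof -
  have "even p \<Longrightarrow> odd q" using assms(1) by (auto dest: coprime_common_divisor)
  then show ?thesis
    using assms(2) fraction_value_add[of q p] fraction_value_diff[of q p]
    by (auto simp: fraction_value_commute[of p])
qed

lemma rational_tangle_invariant:
  assumes "rational_tangle T F"
  shows "\<exists>p q lab. coprime p q \<and> F = frac p q \<and>
    rational_invariant T (fraction_type p q) (fraction_value p q) lab"
proof -
  let ?I = "\<lambda>T F. \<exists>p q lab. coprime p q \<and> F = frac p q \<and>
    rational_invariant T (fraction_type p q) (fraction_value p q) lab"
  have right: "?I (place_right T (elementary P)) (frac_add F (of_int (crossing_value P)))"
    if "?I T F" and P: "P \<in> {Cross_Plus, Cross_Minus}" for T F P
  proof -
    obtain p q lab where pq: "coprime p q" "F = frac p q"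
      and inv: "rational_invariant T (fraction_type p q) (fraction_value p q) lab"
      using \<open>?I T F\<close> by blast
    let ?p = "p + crossing_value P * q"
    have s: "crossing_value P \<in> {1, -1}" by (simp add: crossing_value_def)
    have "coprime ?p q" using pq(1) by (simp add: coprime_iff_gcd_eq_1 gcd_add_mult add.commute[of p] gcd.commute)
    moreover have "frac_add F (of_int (crossing_value P)) = frac ?p q"
      by (simp only: pq(2) frac_add_frac)
    moreover have "\<exists>lab'. rational_invariant (place_right T (elementary P))
        (fraction_type ?p q) (fraction_value ?p q) lab'"
      using rational_invariant_place_right[OF inv P twist_right_fraction[OF s]] .
    ultimately show ?thesis by blast
  qed
  have below: "?I (place_below T (elementary P))
      (frac_inverse (frac_add (frac_inverse F) (of_int (crossing_value P))))"
    if "?I T F" and P: "P \<in> {Cross_Plus, Cross_Minus}" for T F P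
  proof -
    obtain p q lab where pq: "coprime p q" "F = frac p q"
      and inv: "rational_invariant T (fraction_type p q) (fraction_value p q) lab"
      using \<open>?I T F\<close> by blast
    let ?q = "q + crossing_value P * p"
    have s: "crossing_value P \<in> {1, -1}" by (simp add: crossing_value_def)
    have cop: "coprime p ?q" using pq(1) by (simp add: coprime_iff_gcd_eq_1 gcd_add_mult add.commute[of q])
    moreover have "frac_inverse (frac_add (frac_inverse F) (of_int (crossing_value P))) = frac p ?q"
      using pq(1) cop by (simp only: pq(2) frac_add_frac frac_inverse_frac coprime_commute)
    moreover have "\<exists>lab'. rational_invariant (place_below T (elementary P))
        (fraction_type p ?q) (fraction_value p ?q) lab'"
      using rational_invariant_place_below[OF inv P twist_below_fraction[OF pq(1) s]] .
    ultimately show ?thesis by blast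
  qed
  show ?thesis using assms
  proof induction
    case zero
    have "rational_invariant (elementary Horizontal_Arcs) (fraction_type 0 1) (fraction_value 0 1)
      (joined_to_NW H_type \<circ> snd)"
      using rational_invariant_horizontal by (simp add: fraction_value_def)
    then show ?case by (intro exI[of _ 0] exI[of _ 1] exI) (simp add: frac_def)
  next
    case (right_plus T F)
    then show ?case using right[where T = T and F = F and P = Cross_Plus] by (simp add: crossing_value_def)
  next
    case (right_minus T F)
    then show ?case using right[where T = T and F = F and P = Cross_Minus] by (simp add: crossing_value_def)
  next
    case (below_plus T F)
    then show ?case using below[where T = T and F = F and P = Cross_Plus] by (simp add: crossing_value_def)
  next
    case (below_minus T F)
    then show ?case using below[where T = T and F = F and P = Cross_Minus] by (simp add: crossing_value_def)
  qed
qed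

lemma rational_pq_tangle_invariant:
  assumes "rational_pq_tangle p q T"
  obtains lab where "rational_invariant T (fraction_type p q) (fraction_value p q) lab"
proof -
  have pq: "coprime p q" and "rational_tangle T (frac p q)"
    using assms by (auto simp: rational_pq_tangle_def)
  then obtain p' q' lab where p'q': "coprime p' q'" "frac p q = frac p' q'"
    and inv: "rational_invariant T (fraction_type p' q') (fraction_value p' q') lab"
    using rational_tangle_invariant by blast
  from coprime_frac_eq[OF pq p'q']
  have "fraction_type p' q' = fraction_type p q" "fraction_value p' q' = fraction_value p q"
    by (auto simp: fraction_value_minus fraction_value_minus_right)
  then show ?thesis using inv that by metis
qed

section \<open>The linking number of a rational link\<close>

lemma crossings_between_commute: "crossings_between D C C' = crossings_between D C' C"
  unfolding crossings_between_def by auto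

lemma linking_number_commute: "linking_number D \<omega> C C' = linking_number D \<omega> C' C"
  unfolding linking_number_def by (simp add: crossings_between_commute)

lemma crossings_between_strands:
  "crossings_between D {x \<in> points D. lab x} {x \<in> points D. \<not> lab x} =
   crossings_between D {x. lab x} {x. \<not> lab x}"
  unfolding crossings_between_def points_def by auto

lemma edges_numerator_closure: "edges (numerator_closure T) =
  edges T \<union> {(ends T NW, ends T NE), (ends T SW, ends T SE)}"
  by (auto simp: edges_def numerator_closure_def)

text \<open>In an \<open>H\<close>-tangle the closing arcs connect points that are connected already.\<close>

lemma components_numerator_closure:
  assumes "two_stranded T H_type lab"
  shows "components (numerator_closure T) = {{x \<in> points T. lab x}, {x \<in> points T. \<not> lab x}}"
proof -
  have "(ends T NW, ends T NE) \<in> connection T" "(ends T SW, ends T SE) \<in> connection T"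
    by (rule two_strandedD(5)[OF assms two_strandedD(1)[OF assms] two_strandedD(1)[OF assms]];
        simp add: two_strandedD(2)[OF assms])+
  then have "connection (numerator_closure T) = connection T"
    by (intro connection_eqI) (auto simp: edges_numerator_closure intro: edge_connection)
  moreover have "points (numerator_closure T) = points T"
    by (simp add: points_def numerator_closure_def)
  ultimately have "components (numerator_closure T) = components T"
    by (simp add: components_def component_of_def)
  then show ?thesis using components_two_stranded[OF assms] by simp
qed

lemma linking_number_rational_link:
  assumes link: "oriented_rational_link p q L \<omega>" and "fraction_type p q = H_type"
    and C: "components L = {C, C'}" "C \<noteq> C'"
  shows "linking_number L \<omega> C C' = of_int (fraction_value p q) / 2"
proof -
  obtain T where T: "rational_pq_tangle p q T" "L = numerator_closure T" "orientation L \<omega>"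
    "\<not> \<omega> (ends T NW)" "\<omega> (ends T SW)"
    using link unfolding oriented_rational_link_def by blast
  obtain lab where inv: "rational_invariant T H_type (fraction_value p q) lab"
    using rational_pq_tangle_invariant[OF T(1)] assms(2) by metis
  then have two: "two_stranded T H_type lab" by (simp add: rational_invariant_def)
  let ?S = "{x \<in> points T. lab x}" and ?S' = "{x \<in> points T. \<not> lab x}"
  have "orientation T \<omega>"
    using T(2,3) by (auto simp: orientation_def edges_numerator_closure)
  then have sum: "interstrand_sum T lab \<omega> = fraction_value p q"
    using inv T(4,5) unfolding rational_invariant_def by simp
  have pieces: "pieces L = pieces T" by (simp add: T(2) numerator_closure_def)
  have "linking_number L \<omega> ?S ?S' = linking_number T \<omega> ?S ?S'"
    by (simp add: linking_number_def crossings_between_def crossing_sign_def pieces)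
  also have "\<dots> = of_int (fraction_value p q) / 2"
    using sum by (simp add: linking_number_def crossings_between_strands interstrand_sum_def)
  finally have lk: "linking_number L \<omega> ?S ?S' = of_int (fraction_value p q) / 2" .
  have "{C, C'} = {?S, ?S'}"
    using C(1) components_numerator_closure[OF two] T(2) by simp
  then have "C = ?S \<and> C' = ?S' \<or> C = ?S' \<and> C' = ?S" by (simp only: doubleton_eq_iff)
  then show ?thesis using lk linking_number_commute[of L \<omega> ?S ?S'] by auto
qed

text \<open>
  The definite description needs a witness, hence some orientation of some \<open>p/q\<close>-tangle. Any
  orientation will do, since each strand can be reversed separately to obtain the prescribed
  directions at the ends.
\<close>

lemma lk_R_eq:
  assumes T: "rational_pq_tangle p q T" and H: "fraction_type p q = H_type"
    and \<omega>: "orientation T \<omega>"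
  shows "lk_R p q = of_int (fraction_value p q) / 2"
proof -
  obtain lab where inv: "rational_invariant T H_type (fraction_value p q) lab"
    using rational_pq_tangle_invariant[OF T] H by metis
  then have two: "two_stranded T H_type lab" by (simp add: rational_invariant_def)
  have alt: "\<omega> (ends T NW) \<noteq> \<omega> (ends T NE)" "\<omega> (ends T SW) \<noteq> \<omega> (ends T SE)"
    using inv \<omega> unfolding rational_invariant_def by auto
  define \<omega>' where "\<omega>' x \<longleftrightarrow> \<omega> x \<noteq> \<omega> (ends T (if lab x then NW else SE))" for x
  let ?L = "numerator_closure T"
  have ends_\<omega>': "\<omega>' (ends T NE)" "\<not> \<omega>' (ends T NW)" "\<omega>' (ends T SW)" "\<not> \<omega>' (ends T SE)"
    using alt by (auto simp: \<omega>'_def two_strandedD(2)[OF two])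
  have "\<omega>' x \<noteq> \<omega>' y" if "(x, y) \<in> edges T" for x y
    using that \<omega> two_strandedD(3)[OF two that] by (auto simp: orientation_def \<omega>'_def)
  then have "orientation ?L \<omega>'"
    using ends_\<omega>' by (auto simp: orientation_def edges_numerator_closure)
  then have link: "oriented_rational_link p q ?L \<omega>'"
    using T ends_\<omega>' unfolding oriented_rational_link_def by blast
  define S where "S = {x \<in> points T. lab x}"
  define S' where "S' = {x \<in> points T. \<not> lab x}"
  have components: "components ?L = {S, S'}"
    using components_numerator_closure[OF two] by (simp only: S_def S'_def)
  have "ends T NW \<in> S" "ends T NW \<notin> S'"
    using two_strandedD(1,2)[OF two] by (simp_all add: S_def S'_def)
  then have ne: "S \<noteq> S'" by blast
  have lk: "of_int (fraction_value p q) / 2 = linking_number ?L \<omega>' S S'"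
    by (rule linking_number_rational_link[OF link H components ne, symmetric])
  show ?thesis unfolding lk_R_def
  proof (rule the_equality)
    show "\<exists>L \<omega> C C'. oriented_rational_link p q L \<omega> \<and> components L = {C, C'} \<and> C \<noteq> C' \<and>
        of_int (fraction_value p q) / 2 = linking_number L \<omega> C C'"
      by (intro exI[of _ ?L] exI[of _ \<omega>'] exI[of _ S] exI[of _ S'] conjI link components ne lk)
  next
    fix l :: rat
    assume "\<exists>L \<omega> C C'. oriented_rational_link p q L \<omega> \<and> components L = {C, C'} \<and> C \<noteq> C' \<and>
        l = linking_number L \<omega> C C'"
    then obtain L \<omega> C C' where "oriented_rational_link p q L \<omega>" "components L = {C, C'}" "C \<noteq> C'"
      and l: "l = linking_number L \<omega> C C'" by (elim exE conjE)
    then show "l = of_int (fraction_value p q) / 2"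
      unfolding l by (intro linking_number_rational_link[OF _ H])
  qed
qed

section \<open>Stacks of tangles\<close>

abbreviation offset :: "tangle list \<Rightarrow> nat \<Rightarrow> nat" where
  "offset Vs k \<equiv> \<Sum>j<k. length (pieces (Vs ! j))"

lemma embed_Pair: "embed Vs k (i, c) = (offset Vs k + i, c)"
  by (simp add: embed_def shift_def)

lemma embed_Cons_0: "embed (T # Vs) 0 = id"
  by (simp add: embed_def shift_def fun_eq_iff)

lemma embed_Cons_Suc: "embed (T # Vs) (Suc k) x = shift (length (pieces T)) (embed Vs k x)"
  by (cases x) (simp add: embed_def shift_def sum.lessThan_Suc_shift del: sum.lessThan_Suc)

definition seam :: "tangle list \<Rightarrow> nat \<Rightarrow> nat \<Rightarrow> (point \<times> point) set" where
  "seam Vs k l = {(embed Vs k (ends (Vs ! k) SW), embed Vs l (ends (Vs ! l) NW)),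
     (embed Vs k (ends (Vs ! k) SE), embed Vs l (ends (Vs ! l) NE))}"

abbreviation embed_edge :: "tangle list \<Rightarrow> nat \<Rightarrow> point \<times> point \<Rightarrow> point \<times> point" where
  "embed_edge Vs k \<equiv> map_prod (embed Vs k) (embed Vs k)"

lemma pieces_stack: "pieces (foldr place_below Us U) = concat (map pieces (Us @ [U]))"
  by (induction Us) (simp_all add: place_below_def Let_def)

lemma ends_stack:
  "ends (foldr place_below Us U) c =
     (let Vs = Us @ [U]; k = (if c \<in> {NW, NE} then 0 else length Us) in embed Vs k (ends (Vs ! k) c))"
proof (induction Us)
  case Nil
  then show ?case by (simp add: embed_Cons_0)
next
  case (Cons T Us)
  then show ?case
    by (cases c) (simp_all add: place_below_def Let_def embed_Cons_0 embed_Cons_Suc)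
qed

lemma UN_lessThan_Suc: "(\<Union>k<Suc n. f k) = f 0 \<union> (\<Union>k<n. f (Suc k))"
  by (auto simp: less_Suc_eq_0_disj)

lemma joins_stack:
  "joins (foldr place_below Us U) = (let Vs = Us @ [U] in
     (\<Union>k<Suc (length Us). embed_edge Vs k ` joins (Vs ! k)) \<union> (\<Union>k<length Us. seam Vs k (Suc k)))"
proof (induction Us)
  case Nil
  then show ?case by (simp add: embed_Cons_0 prod.map_id0 lessThan_Suc)
next
  case (Cons T Us)
  let ?W = "foldr place_below Us U" and ?Vs = "Us @ [U]" and ?s = "shift (length (pieces T))"
  have step: "embed_edge (T # ?Vs) (Suc k) ` A = map_prod ?s ?s ` embed_edge ?Vs k ` A" for k A
    by (force simp: embed_Cons_Suc image_image map_prod_def case_prod_beta)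
  have seam_step: "seam (T # ?Vs) (Suc k) (Suc l) = map_prod ?s ?s ` seam ?Vs k l" for k l
    by (simp add: seam_def embed_Cons_Suc)
  have "joins (place_below T ?W) = joins T \<union> map_prod ?s ?s ` joins ?W \<union>
      {(ends T SW, ?s (ends ?W NW)), (ends T SE, ?s (ends ?W NE))}"
    by (simp add: place_below_def Let_def)
  also have "{(ends T SW, ?s (ends ?W NW)), (ends T SE, ?s (ends ?W NE))} = seam (T # ?Vs) 0 (Suc 0)"
    by (simp add: seam_def ends_stack Let_def embed_Cons_0 embed_Cons_Suc)
  also have "joins T = embed_edge (T # ?Vs) 0 ` joins ((T # ?Vs) ! 0)"
    by (simp add: embed_Cons_0 prod.map_id0)
  also have "map_prod ?s ?s ` joins ?W =
      (\<Union>k<Suc (length Us). embed_edge (T # ?Vs) (Suc k) ` joins ((T # ?Vs) ! Suc k)) \<union>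
      (\<Union>k<length Us. seam (T # ?Vs) (Suc k) (Suc (Suc k)))"
    by (simp only: Cons.IH Let_def step seam_step image_Un image_UN nth_Cons_Suc)
  finally show ?case
    by (simp only: Let_def foldr.simps comp_apply append_Cons list.size(4) add_0_right add_Suc_right
        UN_lessThan_Suc) auto
qed

lemma concat_index:
  fixes xss :: "'b list list"
  shows "i < length (concat xss) \<longleftrightarrow>
     (\<exists>k<length xss. \<exists>j<length (xss ! k). i = (\<Sum>l<k. length (xss ! l)) + j)"
proof (induction xss arbitrary: i)
  case (Cons xs xss)
  have "i < length (concat (xs # xss)) \<longleftrightarrow> i < length xs \<or>
      (length xs \<le> i \<and> i - length xs < length (concat xss))"
    by auto
  also have "\<dots> \<longleftrightarrow> (\<exists>k<length (xs # xss). \<exists>j<length ((xs # xss) ! k).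
      i = (\<Sum>l<k. length ((xs # xss) ! l)) + j)"
    unfolding Cons.IH
    by (simp add: Ex_less_Suc2 sum.lessThan_Suc_shift del: sum.lessThan_Suc)
      (auto simp: le_iff_add)
  finally show ?case .
qed simp

lemma concat_nth:
  fixes xss :: "'b list list"
  assumes "k < length xss" and "j < length (xss ! k)"
  shows "concat xss ! ((\<Sum>l<k. length (xss ! l)) + j) = xss ! k ! j"
  using assms
proof (induction xss arbitrary: k)
  case (Cons xs xss)
  then show ?case
    by (cases k) (simp_all add: nth_append sum.lessThan_Suc_shift add.assoc del: sum.lessThan_Suc)
qed simp

lemma offset_unique:
  assumes "offset Vs k + j = offset Vs k' + j'"
    and "j < length (pieces (Vs ! k))" and "j' < length (pieces (Vs ! k'))"
  shows "k = k'"
proof -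
  have "\<not> k < k'" if "offset Vs k + j = offset Vs k' + j'" "j < length (pieces (Vs ! k))" for k k' j j'
  proof
    assume "k < k'"
    then have "offset Vs (Suc k) \<le> offset Vs k'" by (intro sum_mono2) auto
    then show False using that by simp
  qed
  from this[OF assms(1,2)] this[OF assms(1)[symmetric] assms(3)] show ?thesis by simp
qed

section \<open>Closing a stack to a ring\<close>

text \<open>
  A Montesinos link with its half twists listed among the tangles, so that all members of the ring are
  treated alike.
\<close>

locale tangle_ring =
  fixes Vs :: "tangle list" and t :: "nat \<Rightarrow> tangle_type" and lab :: "nat \<Rightarrow> point \<Rightarrow> bool"
    and L :: diagram
  assumes two: "k < length Vs \<Longrightarrow> two_stranded (Vs ! k) (t k) (lab k)"
    and nonempty: "Vs \<noteq> []"
    and L: "L = vertical_closure (foldr place_below (butlast Vs) (last Vs))"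
begin

abbreviation N :: nat where "N \<equiv> length Vs"

abbreviation succ :: "nat \<Rightarrow> nat" where "succ k \<equiv> Suc k mod N"

lemma N_pos: "N > 0"
  using nonempty by simp

lemma pieces_L: "pieces L = concat (map pieces Vs)"
  using nonempty by (simp add: L vertical_closure_def pieces_stack)

lemma piece_index:
  "i < length (pieces L) \<longleftrightarrow> (\<exists>k<N. \<exists>j<length (pieces (Vs ! k)). i = offset Vs k + j)"
proof -
  have "(\<Sum>l<k. length (map pieces Vs ! l)) = offset Vs k" if "k < N" for k
    using that by (intro sum.cong) auto
  then show ?thesis unfolding pieces_L concat_index by auto
qed

lemma nth_pieces_L:
  assumes "k < N" "j < length (pieces (Vs ! k))"
  shows "pieces L ! (offset Vs k + j) = pieces (Vs ! k) ! j"
proof -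
  have "(\<Sum>l<k. length (map pieces Vs ! l)) = offset Vs k"
    using assms by (intro sum.cong) auto
  then show ?thesis using concat_nth[of k "map pieces Vs" j] assms by (simp add: pieces_L)
qed

lemma embed_unique:
  assumes "embed Vs k x = embed Vs k' x'" "x \<in> points (Vs ! k)" "x' \<in> points (Vs ! k')"
  shows "k = k' \<and> x = x'"
proof -
  have eq: "offset Vs k + fst x = offset Vs k' + fst x'" "snd x = snd x'"
    using assms(1) by (cases x; cases x'; simp add: embed_Pair)+
  moreover have "k = k'"
    using offset_unique[OF eq(1)] assms(2,3) by (auto simp: points_def mem_Times_iff)
  ultimately show ?thesis by (simp add: prod_eq_iff)
qed

lemma joins_L:
  "joins L = (\<Union>k<N. embed_edge Vs k ` joins (Vs ! k)) \<union> (\<Union>k<N. seam Vs k (succ k))"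
proof -
  let ?n = "length (butlast Vs)"
  have V: "butlast Vs @ [last Vs] = Vs" and n: "N = Suc ?n" using nonempty by simp_all
  let ?W = "foldr place_below (butlast Vs) (last Vs)"
  have "joins L = joins ?W \<union> {(ends ?W SW, ends ?W NW), (ends ?W SE, ends ?W NE)}"
    by (simp add: L vertical_closure_def)
  also have "{(ends ?W SW, ends ?W NW), (ends ?W SE, ends ?W NE)} = seam Vs ?n (succ ?n)"
    using n by (simp add: ends_stack V Let_def seam_def del: length_butlast)
  also have "joins ?W = (\<Union>k<N. embed_edge Vs k ` joins (Vs ! k)) \<union> (\<Union>k<?n. seam Vs k (succ k))"
    using n by (simp add: joins_stack V Let_def del: length_butlast)
  finally show ?thesis
    by (simp only: n lessThan_Suc) auto
qed

lemma edges_L: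
  "edges L = (\<Union>k<N. embed_edge Vs k ` edges (Vs ! k)) \<union> (\<Union>k<N. seam Vs k (succ k))"
proof -
  have "{((i, a), (i, b)) | i a b. i < length (pieces L) \<and> (a, b) \<in> piece_strands (pieces L ! i)}
    = (\<Union>k<N. embed_edge Vs k ` {((i, a), (i, b)) | i a b. i < length (pieces (Vs ! k)) \<and>
        (a, b) \<in> piece_strands (pieces (Vs ! k) ! i)})" (is "?A = ?B")
  proof (intro equalityI subsetI)
    fix z assume "z \<in> ?A"
    then obtain i a b where "z = ((i, a), (i, b))" "i < length (pieces L)"
      "(a, b) \<in> piece_strands (pieces L ! i)" by blast
    then obtain k j where "k < N" "j < length (pieces (Vs ! k))"
      "z = embed_edge Vs k ((j, a), (j, b))" "(a, b) \<in> piece_strands (pieces (Vs ! k) ! j)"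
      unfolding piece_index by (auto simp: nth_pieces_L embed_Pair)
    then show "z \<in> ?B" by blast
  next
    fix z assume "z \<in> ?B"
    then obtain k j a b where "k < N" "j < length (pieces (Vs ! k))"
      "z = embed_edge Vs k ((j, a), (j, b))" "(a, b) \<in> piece_strands (pieces (Vs ! k) ! j)"
      by (elim UN_E imageE CollectE exE conjE) auto
    moreover from this have "offset Vs k + j < length (pieces L)" unfolding piece_index by blast
    ultimately show "z \<in> ?A" by (simp add: embed_Pair nth_pieces_L)
  qed
  then show ?thesis
    unfolding edges_def joins_L image_Un UN_Un_distrib by (simp add: Un_assoc)
qed

lemma embed_edge_in: "k < N \<Longrightarrow> (x, y) \<in> edges (Vs ! k) \<Longrightarrow> (embed Vs k x, embed Vs k y) \<in> edges L"
  unfolding edges_L by (intro UnI1 UN_I[of k]) (auto intro: rev_image_eqI)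

lemma embed_connection:
  "k < N \<Longrightarrow> (x, y) \<in> connection (Vs ! k) \<Longrightarrow> (embed Vs k x, embed Vs k y) \<in> connection L"
  by (rule connection_image[OF embed_edge_in])

lemma orientation_embed:
  assumes "orientation L \<omega>" and "k < N"
  shows "orientation (Vs ! k) (\<omega> \<circ> embed Vs k)"
  using assms(1) embed_edge_in[OF assms(2)] unfolding orientation_def by fastforce

subsection \<open>Strands between consecutive \<open>H\<close>-tangles are connected\<close>

definition bottom_joined :: "nat \<Rightarrow> bool" where
  "bottom_joined k \<longleftrightarrow>
     (embed Vs k (ends (Vs ! k) SW), embed Vs k (ends (Vs ! k) SE)) \<in> connection L"

lemma strand_connection:
  assumes "k < N" "x \<in> points (Vs ! k)" "y \<in> points (Vs ! k)" "lab k x = lab k y"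
  shows "(embed Vs k x, embed Vs k y) \<in> connection L"
  using assms two_strandedD(5)[OF two] embed_connection by blast

lemma ends_connection:
  assumes "k < N" "joined_to_NW (t k) c = joined_to_NW (t k) d"
  shows "(embed Vs k (ends (Vs ! k) c), embed Vs k (ends (Vs ! k) d)) \<in> connection L"
  using assms two_strandedD(1,2)[OF two] by (intro strand_connection) auto

lemma bottom_joined_H: "k < N \<Longrightarrow> t k = H_type \<Longrightarrow> bottom_joined k"
  unfolding bottom_joined_def by (rule ends_connection) simp_all

text \<open>
  A \<open>V\<close>- or \<open>D\<close>-tangle carries its two top ends to its two bottom ends, in one order or the other.
\<close>

lemma bottom_joined_succ:
  assumes "k < N" "bottom_joined k"
  shows "bottom_joined (succ k)"
proof (cases "t (succ k) = H_type")
  case True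
  then show ?thesis using N_pos by (intro bottom_joined_H) simp_all
next
  case False
  let ?l = "succ k"
  let ?e = "\<lambda>c. embed Vs ?l (ends (Vs ! ?l) c)"
  have l: "?l < N" using N_pos by simp
  have "seam Vs k ?l \<subseteq> edges L" unfolding edges_L using assms(1) by blast
  then have "(embed Vs k (ends (Vs ! k) SW), ?e NW) \<in> connection L"
    "(embed Vs k (ends (Vs ! k) SE), ?e NE) \<in> connection L"
    unfolding seam_def by (auto intro: edge_connection)
  then have top: "(?e NW, ?e NE) \<in> connection L"
    using assms(2) unfolding bottom_joined_def by (meson connection_sym rtrancl_trans)
  show ?thesis
  proof (cases "t ?l")
    case V_type
    then have "(?e SW, ?e NW) \<in> connection L" "(?e NE, ?e SE) \<in> connection L"
      using ends_connection[OF l] by simp_all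
    then show ?thesis unfolding bottom_joined_def using top by (meson rtrancl_trans)
  next
    case D_type
    then have "(?e SW, ?e NE) \<in> connection L" "(?e NW, ?e SE) \<in> connection L"
      using ends_connection[OF l] by simp_all
    then show ?thesis unfolding bottom_joined_def using top by (meson connection_sym rtrancl_trans)
  qed (use False in simp)
qed

lemma bottom_joined_all:
  assumes "k0 < N" "t k0 = H_type" "k < N"
  shows "bottom_joined k"
proof -
  have "bottom_joined ((k0 + i) mod N)" for i
  proof (induction i)
    case 0
    then show ?case using assms bottom_joined_H by simp
  next
    case (Suc i)
    then have "bottom_joined (succ ((k0 + i) mod N))" using N_pos by (intro bottom_joined_succ) simp_all
    then show ?case by (simp add: mod_Suc_eq)
  qed
  from this[of "k + (N - k0)"] show ?thesis using assms by simp
qed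

lemma not_H_connected:
  assumes "k0 < N" "t k0 = H_type" "k < N" "t k \<noteq> H_type"
    and "x \<in> points (Vs ! k)" "y \<in> points (Vs ! k)"
  shows "(embed Vs k x, embed Vs k y) \<in> connection L"
proof -
  let ?e = "\<lambda>c. embed Vs k (ends (Vs ! k) c)"
  have bottom: "(?e SW, ?e SE) \<in> connection L"
    using bottom_joined_all[OF assms(1-3)] by (simp add: bottom_joined_def)
  have "(?e SW, embed Vs k z) \<in> connection L" if z: "z \<in> points (Vs ! k)" for z
  proof -
    have "joined_to_NW (t k) SW \<noteq> joined_to_NW (t k) SE" using assms(4) by (cases "t k") simp_all
    then have "lab k (ends (Vs ! k) SW) = lab k z \<or> lab k (ends (Vs ! k) SE) = lab k z"
      using two_strandedD(2)[OF two[OF assms(3)]] by auto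
    then show ?thesis
      using strand_connection[OF assms(3) two_strandedD(1)[OF two[OF assms(3)]] z] bottom
      by (meson rtrancl_trans)
  qed
  then show ?thesis using assms(5,6) by (meson connection_sym rtrancl_trans)
qed

subsection \<open>Distinct gaps between \<open>H\<close>-tangles are not connected\<close>

definition H_before :: "nat \<Rightarrow> nat" where
  "H_before k = card {j. j < k \<and> t j = H_type}"

lemma H_before_0: "H_before 0 = 0"
  by (simp add: H_before_def)

lemma H_before_Suc: "H_before (Suc k) = H_before k + (if t k = H_type then 1 else 0)"
proof -
  have "{j. j < Suc k \<and> t j = H_type} =
    (if t k = H_type then insert k {j. j < k \<and> t j = H_type} else {j. j < k \<and> t j = H_type})"
    by (auto simp: less_Suc_eq)
  then show ?thesis by (simp add: H_before_def)
qed

lemma H_before_less: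
  assumes "k < l" "t k = H_type"
  shows "H_before k < H_before l"
  unfolding H_before_def using assms by (intro psubset_card_mono) auto

text \<open>
  The number of \<open>H\<close>-tangles passed on the way down to a point, where the lower strand of an
  \<open>H\<close>-tangle lies already behind it. Taken modulo the total number, it is not
  changed by the arcs that lead from the bottom of the ring back to its top.
\<close>

definition level :: "nat \<Rightarrow> point \<Rightarrow> nat" where
  "level k x = (H_before k + (if t k = H_type \<and> \<not> lab k x then 1 else 0)) mod H_before N"

text \<open>
  A point of the link lies in only one tangle (\<open>embed_unique\<close>), so nothing is left to choose.
\<close>

definition point_level :: "point \<Rightarrow> nat" where
  "point_level y = (SOME r. \<exists>k<N. \<exists>x \<in> points (Vs ! k). y = embed Vs k x \<and> r = level k x)"

lemma point_level_embed:
  assumes "k < N" "x \<in> points (Vs ! k)"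
  shows "point_level (embed Vs k x) = level k x"
  unfolding point_level_def
  by (rule some_equality) (use assms embed_unique in blast)+

lemma point_level_edge:
  assumes "(y, y') \<in> edges L"
  shows "point_level y = point_level y'"
proof -
  consider k x x' where "k < N" "(x, x') \<in> edges (Vs ! k)" "y = embed Vs k x" "y' = embed Vs k x'"
    | k where "k < N" "(y, y') \<in> seam Vs k (succ k)"
    using assms unfolding edges_L by auto
  then show ?thesis
  proof cases
    case 1
    have j: "joins (Vs ! k) \<subseteq> points (Vs ! k) \<times> points (Vs ! k)"
      using two[OF 1(1)] by (simp add: two_stranded_def)
    show ?thesis
      using 1 edges_in_points[OF j 1(2)] two_strandedD(3)[OF two[OF 1(1)] 1(2)]
      by (simp add: point_level_embed level_def)
  next
    case 2
    let ?l = "succ k"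
    have l: "?l < N" using N_pos by simp
    have lev: "point_level (embed Vs j (ends (Vs ! j) c)) =
        (H_before j + (if t j = H_type \<and> \<not> joined_to_NW H_type c then 1 else 0)) mod H_before N"
      if "j < N" for j c
      using two_strandedD(1,2)[OF two[OF that]] that by (auto simp: point_level_embed level_def)
    have "H_before (Suc k) mod H_before N = H_before ?l mod H_before N"
      using 2(1) N_pos by (cases "Suc k = N") (simp_all add: H_before_0)
    then show ?thesis
      using 2 lev[OF 2(1)] lev[OF l] by (auto simp: seam_def H_before_Suc)
  qed
qed

lemma point_level_connection: "(y, y') \<in> connection L \<Longrightarrow> point_level y = point_level y'"
  by (rule connection_invariant[OF point_level_edge])

text \<open>
  If two residues \<open>r \<noteq> r'\<close> had \<open>{r, r + 1} = {r', r' + 1}\<close>, then \<open>r' = r + 1\<close> and \<open>r = r' + 1\<close>, so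
  the modulus would divide \<open>2\<close>. This is where three \<open>H\<close>-tangles are needed: with two of them, the two
  components meet in both.
\<close>

lemma H_tangle_levels_inj:
  assumes "k < N" "t k = H_type" "k' < N" "t k' = H_type" and "H_before N \<ge> 3"
    and "{H_before k mod H_before N, Suc (H_before k) mod H_before N} =
      {H_before k' mod H_before N, Suc (H_before k') mod H_before N}"
  shows "k = k'"
proof (rule ccontr)
  assume "k \<noteq> k'"
  then have ne: "H_before k \<noteq> H_before k'"
    using H_before_less assms(2,4) by (metis nat_neq_iff)
  have "H_before k < H_before N" "H_before k' < H_before N"
    using H_before_less assms by blast+
  then show False
    using ne assms(5,6) by (auto simp: doubleton_eq_iff mod_Suc split: if_splits)
qed


subsection \<open>Crossings between distinct components\<close>

lemma component_closed:
  assumes "C \<in> components L" "y \<in> C" "(y, y') \<in> connection L"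
  shows "y' \<in> C"
  using assms unfolding components_def component_of_def by (auto intro: rtrancl_trans)

lemma component_connected:
  assumes "C \<in> components L" "y \<in> C" "y' \<in> C"
  shows "(y, y') \<in> connection L"
  using assms unfolding components_def component_of_def
  by (auto intro: rtrancl_trans dest: connection_sym)

lemma components_eqI:
  assumes "C \<in> components L" "C' \<in> components L" "y \<in> C" "y' \<in> C'" "(y, y') \<in> connection L"
  shows "C = C'"
proof -
  have *: "D = component_of L z" if "D \<in> components L" "z \<in> D" for D z
    using component_closed[OF that] component_connected[OF that]
    unfolding component_of_def by blast
  show ?thesis using *[OF assms(1,3)] *[OF assms(2,4)] assms(5) component_of_eq_iff by metis
qed

definition strand :: "nat \<Rightarrow> bool \<Rightarrow> point set" where
  "strand k b = {x \<in> points (Vs ! k). lab k x = b}"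

lemma components_tangle: "k < N \<Longrightarrow> components (Vs ! k) = {strand k True, strand k False}"
  using components_two_stranded[OF two] by (simp add: strand_def)

lemma linked_at_iff:
  assumes "k < N"
  shows "linked_at Vs C C' k \<longleftrightarrow> t k = H_type \<and>
    (\<exists>b. embed Vs k ` strand k b \<subseteq> C \<and> embed Vs k ` strand k (\<not> b) \<subseteq> C')"
proof
  assume "linked_at Vs C C' k"
  then obtain S S' where "H_tangle (Vs ! k)" "components (Vs ! k) = {S, S'}"
    and sub: "embed Vs k ` S \<subseteq> C" "embed Vs k ` S' \<subseteq> C'"
    unfolding linked_at_def by blast
  then have H: "t k = H_type" and "{strand k True, strand k False} = {S, S'}"
    using H_tangle_iff[OF two[OF assms]] components_tangle[OF assms] by simp_all
  then consider "S = strand k True" "S' = strand k False" | "S = strand k False" "S' = strand k True"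
    by (auto simp: doubleton_eq_iff)
  then show "t k = H_type \<and>
    (\<exists>b. embed Vs k ` strand k b \<subseteq> C \<and> embed Vs k ` strand k (\<not> b) \<subseteq> C')"
  proof cases
    case 1
    then show ?thesis using H sub by (intro conjI exI[of _ True]) simp_all
  next
    case 2
    then show ?thesis using H sub by (intro conjI exI[of _ False]) simp_all
  qed
next
  assume R: "t k = H_type \<and> (\<exists>b. embed Vs k ` strand k b \<subseteq> C \<and> embed Vs k ` strand k (\<not> b) \<subseteq> C')"
  then obtain b where b: "embed Vs k ` strand k b \<subseteq> C" "embed Vs k ` strand k (\<not> b) \<subseteq> C'" by blast
  have "components (Vs ! k) = {strand k b, strand k (\<not> b)}"
    using components_tangle[OF assms] by (cases b) (simp_all add: insert_commute)
  moreover have "ends (Vs ! k) NW \<in> strand k True" "ends (Vs ! k) NW \<notin> strand k False"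
    using two_strandedD(1,2)[OF two[OF assms]] R by (simp_all add: strand_def)
  then have "strand k b \<noteq> strand k (\<not> b)" by (cases b) auto
  ultimately show "linked_at Vs C C' k"
    using R b H_tangle_iff[OF two[OF assms]] unfolding linked_at_def by blast
qed

lemma linked_at_commute: "k < N \<Longrightarrow> linked_at Vs C C' k \<longleftrightarrow> linked_at Vs C' C k"
  by (simp add: linked_at_iff ex_bool_eq) blast

text \<open>The levels of \<open>C\<close> and \<open>C'\<close> are those above and below a tangle at which they are linked.\<close>

lemma linked_at_unique:
  assumes C: "C \<in> components L" "C' \<in> components L" and "H_before N \<ge> 3"
    and k: "k < N" "linked_at Vs C C' k" and k': "k' < N" "linked_at Vs C C' k'"
  shows "k = k'"
proof -
  have levels: "point_level ` (C \<union> C') = {H_before l mod H_before N, Suc (H_before l) mod H_before N}"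
    if l: "l < N" "linked_at Vs C C' l" for l
  proof -
    obtain b where H: "t l = H_type" and b: "embed Vs l ` strand l b \<subseteq> C" "embed Vs l ` strand l (\<not> b) \<subseteq> C'"
      using l linked_at_iff by blast
    let ?e = "\<lambda>c. embed Vs l (ends (Vs ! l) c)"
    have ends: "ends (Vs ! l) NW \<in> strand l True" "ends (Vs ! l) SW \<in> strand l False"
      using two_strandedD(1,2)[OF two[OF l(1)]] H by (simp_all add: strand_def)
    have lev: "point_level (?e NW) = H_before l mod H_before N"
      "point_level (?e SW) = Suc (H_before l) mod H_before N"
      using two_strandedD(1,2)[OF two[OF l(1)]] H l(1) by (simp_all add: point_level_embed level_def)
    have "?e NW \<in> C \<and> ?e SW \<in> C' \<or> ?e NW \<in> C' \<and> ?e SW \<in> C"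
      using ends b by (cases b) auto
    moreover have const: "point_level ` D = {point_level y}" if D: "D \<in> components L" "y \<in> D" for D y
    proof -
      have "point_level z = point_level y" if "z \<in> D" for z
        by (rule point_level_connection[OF component_connected[OF D(1) that D(2)]])
      then have "point_level ` D = (\<lambda>_. point_level y) ` D" by (rule image_cong[OF refl])
      then show ?thesis using D(2) by (simp add: image_constant)
    qed
    ultimately show ?thesis
    proof (elim disjE conjE)
      assume "?e NW \<in> C" "?e SW \<in> C'"
      then show ?thesis using const[OF C(1)] const[OF C(2)] lev by (simp add: image_Un insert_commute)
    next
      assume "?e NW \<in> C'" "?e SW \<in> C"
      then show ?thesis using const[OF C(1)] const[OF C(2)] lev by (simp add: image_Un insert_commute)
    qed
  qed
  show ?thesis
    using H_tangle_levels_inj[of k k'] levels[OF k] levels[OF k'] assms linked_at_iff by metis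
qed

text \<open>
  The two strands meeting in such a crossing are different, as they belong to different components;
  their tangle is an \<open>H\<close>-tangle, since otherwise both strands would be connected through the
  closest \<open>H\<close>-tangle above it in the ring.
\<close>

lemma crossing_linked_at:
  assumes C: "C \<in> components L" "C' \<in> components L" "C \<noteq> C'"
    and k0: "k0 < N" "t k0 = H_type" and i: "i \<in> crossings_between L C C'"
  shows "\<exists>k<N. linked_at Vs C C' k \<and>
    i \<in> (+) (offset Vs k) ` crossings_between (Vs ! k) {x. lab k x} {x. \<not> lab k x}"
proof -
  have main: "\<exists>k<N. linked_at Vs D D' k \<and>
      i \<in> (+) (offset Vs k) ` crossings_between (Vs ! k) {x. lab k x} {x. \<not> lab k x}"
    if D: "D \<in> components L" "D' \<in> components L" "D \<noteq> D'" and "i < length (pieces L)"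
      and ab: "a \<in> over_corners (pieces L ! i)" "b \<in> under_corners (pieces L ! i)"
      and iab: "(i, a) \<in> D" "(i, b) \<in> D'" for D D' a b
  proof -
    obtain k j where k: "k < N" and j: "j < length (pieces (Vs ! k))" and ikj: "i = offset Vs k + j"
      using \<open>i < length (pieces L)\<close> piece_index by blast
    have pts: "(j, c) \<in> points (Vs ! k)" for c using j by (simp add: points_def)
    have in_D: "embed Vs k (j, a) \<in> D" "embed Vs k (j, b) \<in> D'"
      using iab by (simp_all add: embed_Pair ikj)
    then have apart: "(embed Vs k (j, a), embed Vs k (j, b)) \<notin> connection L"
      using components_eqI[OF D(1,2)] D(3) by blast
    then have labs: "lab k (j, b) \<longleftrightarrow> \<not> lab k (j, a)"
      using strand_connection[OF k pts pts] by blast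
    have H: "t k = H_type" using not_H_connected[OF k0 k _ pts pts] apart by blast
    have "embed Vs k ` strand k (lab k (j, c)) \<subseteq> E" if "E \<in> components L" "embed Vs k (j, c) \<in> E" for c E
    proof (rule image_subsetI)
      fix x assume "x \<in> strand k (lab k (j, c))"
      then have "(embed Vs k (j, c), embed Vs k x) \<in> connection L"
        using strand_connection[OF k pts] by (simp add: strand_def)
      then show "embed Vs k x \<in> E" by (rule component_closed[OF that])
    qed
    from this[OF D(1) in_D(1)] this[OF D(2) in_D(2)] have "linked_at Vs D D' k"
      unfolding linked_at_iff[OF k] using H labs
      by (intro conjI exI[of _ "lab k (j, a)"]) simp_all
    moreover have "j \<in> crossings_between (Vs ! k) {x. lab k x} {x. \<not> lab k x}"
      using j ab labs nth_pieces_L[OF k j] unfolding crossings_between_lab ikj by auto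
    ultimately show ?thesis using k ikj by blast
  qed
  obtain a b where "i < length (pieces L)" "a \<in> over_corners (pieces L ! i)"
    "b \<in> under_corners (pieces L ! i)" "(i, a) \<in> C \<and> (i, b) \<in> C' \<or> (i, a) \<in> C' \<and> (i, b) \<in> C"
    using i unfolding crossings_between_def by blast
  then show ?thesis using main[OF C, of a b] main[OF C(2,1), of a b] C(3) linked_at_commute by metis
qed

lemma linking_number_linked:
  assumes C: "C \<in> components L" "C' \<in> components L" "C \<noteq> C'"
    and H: "H_before N \<ge> 3" and k: "k < N" "linked_at Vs C C' k"
  shows "linking_number L \<omega> C C' =
    of_int (interstrand_sum (Vs ! k) (lab k) (\<omega> \<circ> embed Vs k)) / 2"
proof -
  let ?X = "crossings_between (Vs ! k) {x. lab k x} {x. \<not> lab k x}"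
  obtain b where "t k = H_type" and b: "embed Vs k ` strand k b \<subseteq> C" "embed Vs k ` strand k (\<not> b) \<subseteq> C'"
    using k linked_at_iff by blast
  have "crossings_between L C C' = (+) (offset Vs k) ` ?X"
  proof
    show "crossings_between L C C' \<subseteq> (+) (offset Vs k) ` ?X"
      using crossing_linked_at[OF C k(1) \<open>t k = H_type\<close>] linked_at_unique[OF C(1,2) H k] by blast
  next
    show "(+) (offset Vs k) ` ?X \<subseteq> crossings_between L C C'"
    proof
      fix i assume "i \<in> (+) (offset Vs k) ` ?X"
      then obtain j a b' where i: "i = offset Vs k + j" and j: "j < length (pieces (Vs ! k))"
        and ab: "a \<in> over_corners (pieces (Vs ! k) ! j)" "b' \<in> under_corners (pieces (Vs ! k) ! j)"
          "lab k (j, a) \<noteq> lab k (j, b')"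
        unfolding crossings_between_lab by blast
      have mem: "(i, c) \<in> embed Vs k ` strand k (lab k (j, c))" for c
        using j by (auto simp: strand_def points_def i embed_Pair intro!: image_eqI[of _ _ "(j, c)"])
      have "(i, a) \<in> C \<and> (i, b') \<in> C' \<or> (i, a) \<in> C' \<and> (i, b') \<in> C"
        using mem[of a] mem[of b'] ab(3) b by (cases "lab k (j, a) = b"; cases b) auto
      moreover have "i < length (pieces L)" using k(1) j i piece_index by blast
      ultimately show "i \<in> crossings_between L C C'"
        using ab(1,2) nth_pieces_L[OF k(1) j] unfolding crossings_between_def i by auto
    qed
  qed
  then have "(\<Sum>i \<in> crossings_between L C C'. crossing_sign L \<omega> i) =
      (\<Sum>j \<in> ?X. crossing_sign L \<omega> (offset Vs k + j))"
    by (simp add: sum.reindex)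
  also have "\<dots> = (\<Sum>j \<in> ?X. crossing_sign (Vs ! k) (\<omega> \<circ> embed Vs k) j)"
    using nth_pieces_L[OF k(1)]
    by (intro sum.cong) (auto simp: crossings_between_lab crossing_sign_def embed_Pair)
  finally show ?thesis by (simp add: linking_number_def interstrand_sum_def)
qed

lemma linking_number_unlinked:
  assumes "C \<in> components L" "C' \<in> components L" "C \<noteq> C'" and "H_before N > 0"
    and "\<And>k. k < N \<Longrightarrow> \<not> linked_at Vs C C' k"
  shows "linking_number L \<omega> C C' = 0"
proof -
  obtain k0 where "k0 < N" "t k0 = H_type"
    using assms(4) unfolding H_before_def by (auto simp: card_gt_0_iff)
  then have "crossings_between L C C' = {}"
    using crossing_linked_at[OF assms(1-3)] assms(5) by blast
  then show ?thesis by (simp add: linking_number_def)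
qed

end

section \<open>Montesinos links\<close>

definition montesinos_pieces :: "tangle list \<Rightarrow> int \<Rightarrow> tangle list" where
  "montesinos_pieces Ts e = Ts @
     replicate (nat \<bar>e\<bar>) (elementary (if e > 0 then Cross_Plus else Cross_Minus)) @
     [elementary Vertical_Arcs]"

lemma montesinos_link_ring:
  "montesinos_link Ts e = vertical_closure
     (foldr place_below (butlast (montesinos_pieces Ts e)) (last (montesinos_pieces Ts e)))"
  by (simp add: montesinos_link_def half_twists_def montesinos_pieces_def butlast_append)

lemma nth_montesinos_pieces:
  "k < length Ts \<Longrightarrow> montesinos_pieces Ts e ! k = Ts ! k"
  by (simp add: montesinos_pieces_def nth_append)

lemma nth_montesinos_pieces_twist:
  assumes "k < length (montesinos_pieces Ts e)" "length Ts \<le> k"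
  obtains P where "montesinos_pieces Ts e ! k = elementary P" "piece_type P \<noteq> H_type"
proof -
  have "k - length Ts < length (replicate (nat \<bar>e\<bar>)
      (elementary (if e > 0 then Cross_Plus else Cross_Minus)) @ [elementary Vertical_Arcs])"
    using assms by (auto simp: montesinos_pieces_def)
  then have "montesinos_pieces Ts e ! k \<in> {elementary Cross_Plus, elementary Cross_Minus, elementary Vertical_Arcs}"
    using assms(2) by (auto simp: montesinos_pieces_def nth_append)
  then show ?thesis using that by fastforce
qed

lemma embed_montesinos_pieces:
  "k \<le> length Ts \<Longrightarrow> embed (montesinos_pieces Ts e) k = embed Ts k"
  by (simp add: embed_def nth_montesinos_pieces)

lemma linked_at_montesinos_pieces:
  "k < length Ts \<Longrightarrow> linked_at (montesinos_pieces Ts e) C C' k = linked_at Ts C C' k"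
  by (simp add: linked_at_def nth_montesinos_pieces embed_montesinos_pieces)

theorem theorem3:
  fixes n :: nat and p q :: "nat \<Rightarrow> int" and e :: int
    and Ts :: "tangle list" and L :: diagram
    and \<omega> :: "point \<Rightarrow> bool" and C C' :: "point set"
  assumes "length Ts = n"
    and "\<And>k. k < n \<Longrightarrow> coprime (p k) (q k)"
    and "\<And>k. k < n \<Longrightarrow> rational_pq_tangle (p k) (q k) (Ts ! k)"
    and "L = montesinos_link Ts e"
    and "orientation L \<omega>"
    and "C \<in> components L" and "C' \<in> components L" and "C \<noteq> C'"
    and "card {k. k < n \<and> H_tangle (Ts ! k)} \<ge> 3"
  shows "(\<forall>k<n. linked_at Ts C C' k \<longrightarrow>
            linking_number L \<omega> C C' = lk_R (p k) (q k) \<or>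
            linking_number L \<omega> C C' = - lk_R (p k) (q k)) \<and>
         ((\<nexists>k. k < n \<and> linked_at Ts C C' k) \<longrightarrow> linking_number L \<omega> C C' = 0)"
proof -
  let ?Vs = "montesinos_pieces Ts e"
  have len: "n < length ?Vs" using assms(1) by (simp add: montesinos_pieces_def)
  have "\<exists>t lab. two_stranded (?Vs ! k) t lab \<and> (k < n \<longrightarrow> t = fraction_type (p k) (q k) \<and>
      rational_invariant (?Vs ! k) t (fraction_value (p k) (q k)) lab)"
    if "k < length ?Vs" for k
  proof (cases "k < n")
    case True
    then have nth: "?Vs ! k = Ts ! k" using assms(1) by (simp add: nth_montesinos_pieces)
    obtain lab where "rational_invariant (Ts ! k) (fraction_type (p k) (q k)) (fraction_value (p k) (q k)) lab"
      using rational_pq_tangle_invariant[OF assms(3)[OF True]] .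
    then show ?thesis unfolding nth using rational_invariant_def by blast
  next
    case False
    then have "length Ts \<le> k" using assms(1) by simp
    from nth_montesinos_pieces_twist[OF that this] obtain P where "?Vs ! k = elementary P" .
    then show ?thesis using two_stranded_elementary[of P] False by auto
  qed
  then obtain t lab where two: "\<And>k. k < length ?Vs \<Longrightarrow> two_stranded (?Vs ! k) (t k) (lab k)"
    and inv: "\<And>k. k < n \<Longrightarrow> t k = fraction_type (p k) (q k) \<and>
      rational_invariant (?Vs ! k) (t k) (fraction_value (p k) (q k)) (lab k)"
    using len by (metis order.strict_trans)
  interpret tangle_ring ?Vs t lab L
    using two len by unfold_locales (auto simp: assms(4) montesinos_link_ring)
  have "3 \<le> card {k. k < n \<and> H_tangle (Ts ! k)}" by (rule assms(9))
  also have "\<dots> \<le> H_before N"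
    unfolding H_before_def
  proof (rule card_mono)
    show "{k. k < n \<and> H_tangle (Ts ! k)} \<subseteq> {j. j < N \<and> t j = H_type}"
    proof clarify
      fix k assume "k < n" "H_tangle (Ts ! k)"
      then show "k < N \<and> t k = H_type"
        using len H_tangle_iff[OF two, of k] assms(1) by (simp add: nth_montesinos_pieces)
    qed
  qed simp
  finally have H: "H_before N \<ge> 3" .
  show ?thesis
  proof (intro conjI allI impI)
    fix k assume k: "k < n" "linked_at Ts C C' k"
    have kN: "k < N" and linked: "linked_at ?Vs C C' k" and nth: "?Vs ! k = Ts ! k"
      using k len assms(1) by (simp_all add: linked_at_montesinos_pieces nth_montesinos_pieces)
    have type: "fraction_type (p k) (q k) = H_type"
      using inv[OF k(1)] linked linked_at_iff[OF kN] by simp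
    have \<omega>: "orientation (Ts ! k) (\<omega> \<circ> embed ?Vs k)"
      using orientation_embed[OF assms(5) kN] by (simp add: nth)
    have lk_R: "lk_R (p k) (q k) = of_int (fraction_value (p k) (q k)) / 2"
      by (rule lk_R_eq[OF assms(3)[OF k(1)] type \<omega>])
    \<comment> \<open>the sign in the statement tells whether \<open>\<omega>\<close> directs the two strands as in the rational link\<close>
    have "interstrand_sum (Ts ! k) (lab k) (\<omega> \<circ> embed ?Vs k) =
        relative_sign H_type (\<omega> \<circ> embed ?Vs k \<circ> ends (Ts ! k)) * fraction_value (p k) (q k)"
      using inv[OF k(1)] \<omega> unfolding rational_invariant_def nth type by metis
    then have "interstrand_sum (Ts ! k) (lab k) (\<omega> \<circ> embed ?Vs k) \<in>
        {fraction_value (p k) (q k), - fraction_value (p k) (q k)}"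
      by simp
    then show "linking_number L \<omega> C C' = lk_R (p k) (q k) \<or>
        linking_number L \<omega> C C' = - lk_R (p k) (q k)"
      unfolding linking_number_linked[OF assms(6-8) H kN linked] lk_R nth by auto
  next
    assume unlinked: "\<nexists>k. k < n \<and> linked_at Ts C C' k"
    have "\<not> linked_at ?Vs C C' k" if "k < N" for k
    proof (cases "k < n")
      case True
      then show ?thesis using unlinked assms(1) by (simp add: linked_at_montesinos_pieces)
    next
      case False
      then have "length Ts \<le> k" using assms(1) by simp
      from nth_montesinos_pieces_twist[OF \<open>k < N\<close> this] obtain P
        where "?Vs ! k = elementary P" "piece_type P \<noteq> H_type" .
      then have "\<not> H_tangle (?Vs ! k)"
        using H_tangle_iff[OF two_stranded_elementary[of P]] by simp
      then show ?thesis unfolding linked_at_def by blast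
    qed
    then show "linking_number L \<omega> C C' = 0"
      using H by (intro linking_number_unlinked[OF assms(6-8)]) linarith+
  qed
qed

end
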